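(* Let $\mathcal{H}$ be a real Hilbert space, let $n\geq 3$ and $L>0$, let $A_1,\dots,A_n\colon\mathcal{H}\rightrightarrows\mathcal{H}$ be maximally monotone and let $B_1,\dots,B_{n-2}\colon\mathcal{H}\to\mathcal{H}$ be monotone and $L$-Lipschitz continuous with $\operatorname{zer}\left(\sum_{i=1}^nA_i+\sum_{i=1}^{n-2}B_i\right)\neq\varnothing$. Further, let $\lambda\in\bigl(0,\frac{1}{2L}\bigr)$ and $\gamma\in\bigl(0,1-2\lambda L\bigr)$. Given $\mathbf{z}^0=(z_1^0,\dots,z_{n-1}^0)\in\mathcal{H}^{n-1}$, let $(\mathbf{z}^k)_{k\geq 0}\subseteq\mathcal{H}^{n-1}$ and $(\mathbf{x}^k)_{k\geq 0}\subseteq\mathcal{H}^n$, with $\mathbf{z}^k=(z_1^k,\dots,z_{n-1}^k)$ and $\mathbf{x}^k=(x_1^k,\dots,x_n^k)$, be the sequences given for all $k\geq 0$ by $$\begin{cases} x_1^k=J_{\lambda A_1}(z_1^k),\\ x_2^k=J_{\lambda A_2}\bigl(z_2^k+x_1^k-z_1^k-\lambda B_1(x_1^k)\bigr),\\ x_i^k=J_{\lambda A_i}\bigl(z_i^k+x_{i-1}^k-z_{i-1}^k-\lambda B_{i-1}(x_{i-1}^k)-\lambda(B_{i-2}(x_{i-1}^k)-B_{i-2}(x_{i-2}^k))\bigr)\quad\forall i\in\{3,\dots,n-1\},\\ x_n^k=J_{\lambda A_n}\bigl(x_1^k+x_{n-1}^k-z_{n-1}^k-\lambda(B_{n-2}(x_{n-1}^k)-B_{n-2}(x_{n-2}^k))\bigr),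 \end{cases}$$ and $$\mathbf{z}^{k+1}=\mathbf{z}^k+\gamma\,\bigl(x_2^k-x_1^k,\;x_3^k-x_2^k,\;\dots,\;x_n^k-x_{n-1}^k\bigr).$$ Then the following assertions hold. (a) The sequence $(\mathbf{z}^k)$ converges weakly to a point $\mathbf{z}\in\operatorname{Fix}\widetilde{T}$, where $\widetilde{T}$ is the operator defined in the context. (b) The sequence $(\mathbf{x}^k)$ converges weakly to a point $(x,\dots,x)\in\mathcal{H}^n$ with $x\in\operatorname{zer}\left(\sum_{i=1}^nA_i+\sum_{i=1}^{n-2}B_i\right)$.
   Context: $\mathcal{H}$ is a real Hilbert space with inner product $\langle\cdot,\cdot\rangle$ and induced norm $\|\cdot\|$; products $\mathcal{H}^m$ carry the usual product Hilbert space structure, $\|\mathbf{z}\|^2=\sum_i\|z_i\|^2$. A set-valued operator $A\colon\mathcal{H}\rightrightarrows\mathcal{H}$ assigns to each $x\in\mathcal H$ a subset $A(x)\subseteq\mathcal{H}$; it is monotone if $\langle x-y,u-v\rangle\geq 0$ whenever $u\in A(x)$, $v\in A(y)$, and maximally monotone if no monotone operator has a graph properly containing its graph. $\operatorname{zer}A=\{x: 0\in A(x)\}$ and $\operatorname{Fix}A=\{x: x\in A(x)\}$ (so $\operatorname{Fix}\widetilde{T}=\{\mathbf{z}:\widetilde{T}(\mathbf{z})=\mathbf{z}\}$ for single-valued $\widetilde{T}$). An operator $B\colon\mathcal{H}\to\mathcal{H}$ is $L$-Lipschitz continuous if $\|B(x)-B(y)\|\leq L\|x-y\|$ for all $x,y$.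 The resolvent of $A$ with parameter $\lambda>0$ is $J_{\lambda A}=(\operatorname{Id}+\lambda A)^{-1}$, which is single-valued with full domain when $A$ is maximally monotone. The operator $\widetilde{T}\colon\mathcal{H}^{n-1}\to\mathcal{H}^{n-1}$ is defined by $\widetilde{T}(\mathbf{z}):=\mathbf{z}+\gamma\,(x_2-x_1,\;x_3-x_2,\;\dots,\;x_n-x_{n-1})$, where $\mathbf{x}=(x_1,\dots,x_n)\in\mathcal{H}^n$ depends on $\mathbf{z}=(z_1,\dots,z_{n-1})\in\mathcal{H}^{n-1}$ via $x_1=J_{\lambda A_1}(z_1)$; $x_2=J_{\lambda A_2}(z_2+x_1-z_1-\lambda B_1(x_1))$; $x_i=J_{\lambda A_i}\bigl(z_i+x_{i-1}-z_{i-1}-\lambda B_{i-1}(x_{i-1})-\lambda(B_{i-2}(x_{i-1})-B_{i-2}(x_{i-2}))\bigr)$ for $i\in\{3,\dots,n-1\}$; and $x_n=J_{\lambda A_n}\bigl(x_1+x_{n-1}-z_{n-1}-\lambda(B_{n-2}(x_{n-1})-B_{n-2}(x_{n-2}))\bigr)$. Thus $\mathbf{z}^{k+1}=\widetilde{T}(\mathbf{z}^k)$. When $n=3$ the index set $\{3,\dots,n-1\}$ is empty. *)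

theory Defs
  imports "HOL-Analysis.Analysis" "HOL-Library.Set_Algebras" "HOL-Library.FuncSet"
begin

definition graph_op :: "('a \<Rightarrow> 'a set) \<Rightarrow> ('a \<times> 'a) set" where
  "graph_op A = {(x, u). u \<in> A x}"

definition monotone_op :: "('a::real_inner \<Rightarrow> 'a set) \<Rightarrow> bool" where
  "monotone_op A \<longleftrightarrow> (\<forall>x y. \<forall>u\<in>A x. \<forall>v\<in>A y. inner (x - y) (u - v) \<ge> 0)"

definition maximally_monotone :: "('a::real_inner \<Rightarrow> 'a set) \<Rightarrow> bool" where
  "maximally_monotone A \<longleftrightarrow>
     monotone_op A \<and> \<not> (\<exists>A'. monotone_op A' \<and> graph_op A \<subset> graph_op A')"

definition zer :: "('a::zero \<Rightarrow> 'a set) \<Rightarrow> 'a set" where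
  "zer A = {x. 0 \<in> A x}"

definition inverse_op :: "('a \<Rightarrow> 'a set) \<Rightarrow> 'a \<Rightarrow> 'a set" where
  "inverse_op A u = {x. u \<in> A x}"

text \<open>The operator \<open>(Id + lam A)\<inverse>\<close> is set-valued in general. When \<open>A\<close> is maximally monotone
  and \<open>lam > 0\<close>, each of its values is a singleton (Minty's theorem), and \<open>resolvent\<close> is the
  corresponding point-valued map; \<open>the_elem\<close> is unspecified on other sets.\<close>

definition resolvent :: "real \<Rightarrow> ('a::real_vector \<Rightarrow> 'a set) \<Rightarrow> 'a \<Rightarrow> 'a" where
  "resolvent lam A u = the_elem (inverse_op (\<lambda>x. (\<lambda>v. x + lam *\<^sub>R v) ` A x) u)"

text \<open>\<open>\<Sum>\<^sub>i A\<^sub>i + \<Sum>\<^sub>i B\<^sub>i\<close>; sums of sets are Minkowski sums.\<close>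

definition sum_op :: "nat \<Rightarrow> (nat \<Rightarrow> 'a::real_vector \<Rightarrow> 'a set) \<Rightarrow> (nat \<Rightarrow> 'a \<Rightarrow> 'a) \<Rightarrow> 'a \<Rightarrow> 'a set"
  where "sum_op n A B x = (\<Sum>i=1..n. A i x) + (\<Sum>i=1..n-2. {B i x})"

text \<open>An \<open>m\<close>-tuple is a function on \<open>{1..m}\<close>, taking the value \<open>undefined\<close> elsewhere, so that
  equality of tuples is HOL equality.\<close>

definition tuples :: "nat \<Rightarrow> (nat \<Rightarrow> 'a) set" where
  "tuples m = {1..m} \<rightarrow>\<^sub>E UNIV"

definition tuple_inner :: "nat \<Rightarrow> (nat \<Rightarrow> 'a::real_inner) \<Rightarrow> (nat \<Rightarrow> 'a) \<Rightarrow> real" where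
  "tuple_inner m v w = (\<Sum>i=1..m. inner (v i) (w i))"

definition tuple_weakly_converges ::
    "nat \<Rightarrow> (nat \<Rightarrow> nat \<Rightarrow> 'a::real_inner) \<Rightarrow> (nat \<Rightarrow> 'a) \<Rightarrow> bool" where
  "tuple_weakly_converges m v w \<longleftrightarrow>
     (\<forall>u\<in>tuples m. (\<lambda>k. tuple_inner m (v k) u) \<longlonglongrightarrow> tuple_inner m w u)"

definition Fix_on :: "'b set \<Rightarrow> ('b \<Rightarrow> 'b) \<Rightarrow> 'b set" where
  "Fix_on S T = {z \<in> S. T z = z}"

text \<open>\<open>x_of n lam A B z\<close> is the tuple \<open>(x\<^sub>1, \<dots>, x\<^sub>n)\<close> determined by \<open>z = (z\<^sub>1, \<dots>, z\<^sub>n\<^sub>-\<^sub>1)\<close>, meaningful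
  for \<open>n \<ge> 3\<close>.\<close>

fun x_of :: "nat \<Rightarrow> real \<Rightarrow> (nat \<Rightarrow> 'a::real_vector \<Rightarrow> 'a set) \<Rightarrow> (nat \<Rightarrow> 'a \<Rightarrow> 'a) \<Rightarrow>
    (nat \<Rightarrow> 'a) \<Rightarrow> nat \<Rightarrow> 'a" where
  "x_of n lam A B z i =
    (if i = 1 then resolvent lam (A 1) (z 1)
     else if i = 2 then
       resolvent lam (A 2) (z 2 + x_of n lam A B z 1 - z 1 - lam *\<^sub>R B 1 (x_of n lam A B z 1))
     else if 3 \<le> i \<and> i \<le> n - 1 then
       resolvent lam (A i)
         (z i + x_of n lam A B z (i - 1) - z (i - 1)
           - lam *\<^sub>R B (i - 1) (x_of n lam A B z (i - 1))
           - lam *\<^sub>R (B (i - 2) (x_of n lam A B z (i - 1)) - B (i - 2) (x_of n lam A B z (i - 2))))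
     else if 3 \<le> i \<and> i = n then
       resolvent lam (A i)
         (x_of n lam A B z 1 + x_of n lam A B z (i - 1) - z (i - 1)
           - lam *\<^sub>R (B (i - 2) (x_of n lam A B z (i - 1)) - B (i - 2) (x_of n lam A B z (i - 2))))
     else undefined)"

declare x_of.simps [simp del]

definition T_tilde :: "nat \<Rightarrow> real \<Rightarrow> real \<Rightarrow> (nat \<Rightarrow> 'a::real_vector \<Rightarrow> 'a set) \<Rightarrow>
    (nat \<Rightarrow> 'a \<Rightarrow> 'a) \<Rightarrow> (nat \<Rightarrow> 'a) \<Rightarrow> (nat \<Rightarrow> 'a)" where
  "T_tilde n lam \<gamma> A B z =
     (\<lambda>i\<in>{1..n-1}. z i + \<gamma> *\<^sub>R (x_of n lam A B z (i + 1) - x_of n lam A B z i))"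

end

(* Put B_0 = B_(n-1) = 0 and z_0 = z_n = x_0 = x_1. The resolvent equations say that
   c_i = (z_(i+1) - z_i - (x_(i+1) - x_i)) / lam + E_i - E_(i-1), where
   E_i = B_i x_(i+1) - B_i x_i, lies in (A_(i+1) + B_i) x_(i+1), and the c_i sum to
   (x_1 - x_n) / lam; fixed points are the solutions with constant x. Monotonicity of all
   A_(i+1) + B_i and summation by parts make (z^k) Fejer monotone with respect to the fixed
   points and force x_(i+1)^k - x_i^k -> 0. Along a weak cluster point the pairing
   sum <x_(i+1), c_i> tends to 0, so the limit is a fixed point, and Opial's argument gives
   weak convergence. Weak cluster points are taken along filters, so that Tychonoff's theorem
   replaces the extraction of subsequences. Minty's theorem comes from Kirszbraun's theorem in
   its one-point form. *)
theory Submission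
  imports Defs
begin

section \<open>Weak cluster points\<close>

text \<open>Resolvents need not be weakly continuous, and the inner products of two weakly
  convergent sequences need not converge, so a single inclusion need not survive a weak limit. The
  coupling does survive: the differences of the \<open>x\<close>-components and the sum of the
  \<open>c\<close>-values vanish strongly, and these two facts are exactly what the summed pairing
  needs. Instead of proving that A_(i+1) + B_i is maximally monotone, a Banach contraction solves y
  + lam w = v with w in (A_(i+1) + B_i) y for every v, which supplies enough test points for the
  limiting inequality. The step sizes have a common origin. Polarization in the summation by parts
  yields half of every squared increment of x; Young's inequality charges the E_i to the increments
  at a total price of at most lam L, leaving 1/2 - lam L. Relaxation by \<gamma> adds \<gamma>^2
  times the squared increments, whence the bound \<gamma> < 1 - 2 lam L.\<close>

lemma Riesz_representation:
  fixes f :: "'a::{real_inner, complete_space} \<Rightarrow> real"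
  assumes f: "bounded_linear f"
  obtains c where "\<And>u. f u = inner c u"
proof -
  interpret f: bounded_linear f by fact
  obtain K where K: "\<And>u. norm (f u) \<le> norm u * K"
    using f.bounded by blast
  \<comment> \<open>The representing vector is the minimiser of \<open>g\<close>: if
    \<open>f\<close> is the inner product with \<open>c\<close>, then \<open>g y\<close> is the
    squared distance from \<open>y\<close> to \<open>c\<close>, up to a constant. Midpoints show
    that near-minimisers form a Cauchy sequence.\<close>
  define g where "g y = (norm y)\<^sup>2 - 2 * f y" for y
  have g_ge: "- K\<^sup>2 \<le> g y" for y
  proof -
    have "0 \<le> (norm y - K)\<^sup>2" by simp
    then show ?thesis using K[of y] by (auto simp: g_def power2_eq_square algebra_simps)
  qed
  then have bdd: "bdd_below (range g)" by (metis bdd_belowI2)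
  define m where "m = Inf (range g)"
  have m_le: "m \<le> g y" for y
    unfolding m_def using bdd by (intro cInf_lower) auto
  have "\<exists>y. g y < m + inverse (real (Suc k))" for k
  proof -
    have "Inf (range g) < m + inverse (real (Suc k))" by (simp add: m_def)
    then show ?thesis using cInf_less_iff[OF _ bdd] by auto
  qed
  then obtain y where y: "\<And>k. g (y k) < m + inverse (real (Suc k))" by metis
  have parallelogram: "(norm (v - w))\<^sup>2 \<le> 2 * ((g v - m) + (g w - m))" for v w
  proof -
    have "g v / 2 + g w / 2 - g ((1/2) *\<^sub>R (v + w)) = (norm (v - w))\<^sup>2 / 4"
      by (simp add: g_def power2_norm_eq_inner f.add f.scaleR inner_simps inner_commute algebra_simps)
        (simp add: field_simps)
    then show ?thesis using m_le[of "(1/2) *\<^sub>R (v + w)"] by argo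
  qed
  have "Cauchy y"
  proof (rule metric_CauchyI)
    fix e :: real assume e: "0 < e"
    then obtain N where N: "inverse (real (Suc N)) < e\<^sup>2 / 4"
      using reals_Archimedean[of "e\<^sup>2 / 4"] by auto
    have "dist (y k) (y l) < e" if "k \<ge> N" "l \<ge> N" for k l
    proof -
      have "inverse (real (Suc k)) \<le> inverse (real (Suc N))"
        and "inverse (real (Suc l)) \<le> inverse (real (Suc N))"
        using that by (auto intro!: le_imp_inverse_le)
      then have "(norm (y k - y l))\<^sup>2 < e\<^sup>2"
        using parallelogram[of "y k" "y l"] y[of k] y[of l] N by argo
      then show ?thesis using e by (simp add: dist_norm power_less_imp_less_base)
    qed
    then show "\<exists>N. \<forall>k\<ge>N. \<forall>l\<ge>N. dist (y k) (y l) < e" by blast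
  qed
  then obtain c where c: "y \<longlonglongrightarrow> c" using Cauchy_convergent convergent_def by blast
  have "(\<lambda>k. g (y k)) \<longlonglongrightarrow> g c"
    unfolding g_def by (intro tendsto_intros c f.tendsto)
  moreover have "(\<lambda>k. m + inverse (real (Suc k))) \<longlonglongrightarrow> m + 0"
    by (intro tendsto_intros LIMSEQ_inverse_real_of_nat)
  ultimately have "g c \<le> m"
    using LIMSEQ_le[of "\<lambda>k. g (y k)" "g c"] y by (fastforce intro: less_imp_le)
  have "f u = inner c u" for u
  proof (rule ccontr)
    assume neq: "f u \<noteq> inner c u"
    define d where "d = f u - inner c u"
    \<comment> \<open>With this \<open>t\<close> minimality gives
      \<open>2 * t * d \<le> t * d\<close>, although \<open>t * d > 0\<close>. The summand 1 keeps
      the denominator positive.\<close>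
    define t where "t = d / ((norm u)\<^sup>2 + 1)"
    have pos: "(norm u)\<^sup>2 + 1 > 0" by (simp add: add_nonneg_pos)
    have "g c \<le> g (c + t *\<^sub>R u)" using m_le \<open>g c \<le> m\<close> order_trans by blast
    moreover have "(norm (c + t *\<^sub>R u))\<^sup>2 = (norm c)\<^sup>2 + 2 * t * inner c u + t\<^sup>2 * (norm u)\<^sup>2"
      unfolding power2_norm_eq_inner
      by (simp add: inner_simps inner_commute algebra_simps power2_eq_square)
    ultimately have "2 * t * d \<le> t\<^sup>2 * (norm u)\<^sup>2"
      by (simp add: g_def d_def f.add f.scaleR algebra_simps)
    also have "\<dots> \<le> t * (t * ((norm u)\<^sup>2 + 1))" by (simp add: power2_eq_square algebra_simps)
    also have "t * ((norm u)\<^sup>2 + 1) = d" using pos by (simp add: t_def)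
    finally have "t * d \<le> 0" by (simp add: mult.commute)
    moreover have "t * d = d\<^sup>2 / ((norm u)\<^sup>2 + 1)" by (simp add: t_def power2_eq_square)
    moreover have "d\<^sup>2 > 0" using neq by (simp add: d_def)
    ultimately show False using pos by (simp add: divide_le_0_iff)
  qed
  then show ?thesis using that by blast
qed

text \<open>The filter is left free because two kinds of index occur: natural numbers for the
  iterates, and finite subsets ordered by inclusion in the passage to infinite families of
  balls.\<close>

definition weakly_tendsto :: "('b \<Rightarrow> 'a::real_inner) \<Rightarrow> 'a \<Rightarrow> 'b filter \<Rightarrow> bool" where
  "weakly_tendsto f c F \<longleftrightarrow> (\<forall>u. ((\<lambda>k. inner (f k) u) \<longlongrightarrow> inner c u) F)"

lemma weakly_tendstoD: "weakly_tendsto f c F \<Longrightarrow> ((\<lambda>k. inner (f k) u) \<longlongrightarrow> inner c u) F"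
  by (simp add: weakly_tendsto_def)

lemma weakly_tendsto_mono: "weakly_tendsto f c F \<Longrightarrow> G \<le> F \<Longrightarrow> weakly_tendsto f c G"
  unfolding weakly_tendsto_def by (meson tendsto_mono)

lemma weakly_tendsto_add:
  "weakly_tendsto f c F \<Longrightarrow> weakly_tendsto g d F \<Longrightarrow> weakly_tendsto (\<lambda>k. f k + g k) (c + d) F"
  by (auto simp: weakly_tendsto_def inner_add_left intro: tendsto_add)

lemma weakly_tendsto_diff:
  "weakly_tendsto f c F \<Longrightarrow> weakly_tendsto g d F \<Longrightarrow> weakly_tendsto (\<lambda>k. f k - g k) (c - d) F"
  by (auto simp: weakly_tendsto_def inner_diff_left intro: tendsto_diff)

lemma weakly_tendsto_scaleR:
  "weakly_tendsto f c F \<Longrightarrow> weakly_tendsto (\<lambda>k. r *\<^sub>R f k) (r *\<^sub>R c) F"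
  by (auto simp: weakly_tendsto_def intro: tendsto_mult_left)

lemma tendsto_imp_weakly_tendsto: "(f \<longlongrightarrow> c) F \<Longrightarrow> weakly_tendsto f c F"
  by (auto simp: weakly_tendsto_def intro: tendsto_intros)

text \<open>This is the Banach-Alaoglu argument: each \<open>f k\<close> acts as a functional with
  values in a product of compact intervals, a pointwise cluster point of these functionals is again
  linear and bounded, and Riesz turns it into a vector.\<close>

lemma bounded_weak_cluster_point:
  fixes f :: "'b \<Rightarrow> 'a::{real_inner, complete_space}"
  assumes F: "F \<noteq> bot" and bound: "\<forall>\<^sub>F k in F. norm (f k) \<le> M"
  obtains G c where "G \<le> F" "G \<noteq> bot" "weakly_tendsto f c G"
proof -
  define S :: "('a \<Rightarrow> real) set" where "S = (\<Pi>\<^sub>E u\<in>UNIV. {- (M * norm u)..M * norm u})"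
  define g where "g k = (\<lambda>u. inner (f k) u)" for k
  have "compactin (product_topology (\<lambda>_::'a. euclidean) UNIV) S"
    unfolding S_def compactin_PiE by simp
  then have "compact S" by (simp add: euclidean_product_topology)
  moreover have "\<forall>\<^sub>F h in filtermap g F. h \<in> S"
    unfolding eventually_filtermap using bound
  proof eventually_elim
    case (elim k)
    have "\<bar>inner (f k) u\<bar> \<le> M * norm u" for u
      using Cauchy_Schwarz_ineq2[of "f k" u] elim by (meson mult_right_mono norm_ge_zero order_trans)
    then show ?case by (auto simp: S_def g_def abs_le_iff minus_le_iff)
  qed
  moreover have "filtermap g F \<noteq> bot" using F by (simp add: filtermap_bot_iff)
  ultimately obtain \<phi> where "\<phi> \<in> S" and \<phi>: "inf (nhds \<phi>) (filtermap g F) \<noteq> bot"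
    unfolding compact_filter by blast
  \<comment> \<open>Pulling the neighbourhoods of \<open>\<phi>\<close> back along \<open>g\<close>
    forces convergence to \<open>\<phi>\<close>; the intersection with \<open>F\<close> is proper
    because \<open>\<phi>\<close> is a cluster point.\<close>
  define G where "G = inf (filtercomap g (nhds \<phi>)) F"
  have "G \<le> F" by (simp add: G_def)
  have "G \<noteq> bot"
  proof
    assume "G = bot"
    then obtain P Q where P: "eventually P (nhds \<phi>)" and Q: "eventually Q F"
      and "\<And>k. P (g k) \<Longrightarrow> Q k \<Longrightarrow> False"
      unfolding G_def trivial_limit_def eventually_inf eventually_filtercomap by metis
    then have "eventually (\<lambda>k. \<not> P (g k)) F" by (metis (mono_tags, lifting) eventually_mono)
    then have "eventually (\<lambda>h. \<not> P h) (filtermap g F)" by (simp add: eventually_filtermap)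
    with P have "eventually (\<lambda>_. False) (inf (nhds \<phi>) (filtermap g F))"
      unfolding eventually_inf by blast
    with \<phi> show False by (simp add: trivial_limit_def)
  qed
  have "filterlim g (nhds \<phi>) G"
    unfolding G_def filterlim_def using filtermap_filtercomap[of g "nhds \<phi>"]
    by (meson filtermap_mono inf_le1 order_trans)
  moreover have "filterlim (\<lambda>h. h u) (nhds (\<phi> u)) (nhds \<phi>)" for u :: 'a
  proof (rule topological_tendstoI)
    fix S :: "real set" assume "open S" "\<phi> u \<in> S"
    have "continuous_on UNIV (\<lambda>h::'a \<Rightarrow> real. h u)"
      by (rule continuous_on_product_then_coordinatewise[OF continuous_on_id])
    then have "open ((\<lambda>h. h u) -` S)" using \<open>open S\<close> by (rule open_vimage[rotated])
    then show "\<forall>\<^sub>F h in nhds \<phi>. h u \<in> S"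
      using \<open>\<phi> u \<in> S\<close> eventually_nhds_in_open[of _ \<phi>] by fastforce
  qed
  ultimately have lim: "((\<lambda>k. inner (f k) u) \<longlongrightarrow> \<phi> u) G" for u
    using filterlim_compose[of "\<lambda>h. h u" _ "nhds \<phi>" g G] by (simp add: g_def)
  have "bounded_linear \<phi>"
  proof (rule bounded_linear_intro)
    fix u v
    have "((\<lambda>k. inner (f k) u + inner (f k) v) \<longlongrightarrow> \<phi> u + \<phi> v) G" by (intro tendsto_add lim)
    then show "\<phi> (u + v) = \<phi> u + \<phi> v"
      using lim[of "u + v"] tendsto_unique[OF \<open>G \<noteq> bot\<close>] by (simp add: inner_add_right)
  next
    fix r u
    have "((\<lambda>k. r * inner (f k) u) \<longlongrightarrow> r * \<phi> u) G" by (intro tendsto_mult_left lim)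
    then show "\<phi> (r *\<^sub>R u) = r *\<^sub>R \<phi> u"
      using lim[of "r *\<^sub>R u"] tendsto_unique[OF \<open>G \<noteq> bot\<close>] by simp
  next
    fix u
    have "\<phi> u \<in> {- (M * norm u)..M * norm u}" using \<open>\<phi> \<in> S\<close> by (auto simp: S_def)
    then show "norm (\<phi> u) \<le> norm u * M" by (auto simp: mult.commute)
  qed
  then obtain c where "\<And>u. \<phi> u = inner c u" by (metis Riesz_representation)
  then have "weakly_tendsto f c G" using lim by (simp add: weakly_tendsto_def)
  with \<open>G \<le> F\<close> \<open>G \<noteq> bot\<close> show ?thesis by (rule that)
qed

lemma bounded_family_weak_cluster_point:
  fixes f :: "'i \<Rightarrow> 'b \<Rightarrow> 'a::{real_inner, complete_space}"
  assumes "finite I" and "F \<noteq> bot"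
    and "\<And>i. i \<in> I \<Longrightarrow> \<exists>M. \<forall>\<^sub>F k in F. norm (f i k) \<le> M"
  shows "\<exists>G c. G \<le> F \<and> G \<noteq> bot \<and> (\<forall>i\<in>I. weakly_tendsto (f i) (c i) G)"
  using assms
proof (induction I rule: finite_induct)
  case (insert j I)
  then obtain G c where G: "G \<le> F" "G \<noteq> bot" "\<forall>i\<in>I. weakly_tendsto (f i) (c i) G" by auto
  obtain M where "\<forall>\<^sub>F k in F. norm (f j k) \<le> M" using insert.prems by blast
  then have "\<forall>\<^sub>F k in G. norm (f j k) \<le> M" using G(1) filter_leD by blast
  then obtain G' d where G': "G' \<le> G" "G' \<noteq> bot" "weakly_tendsto (f j) d G'"
    using bounded_weak_cluster_point G(2) by blast
  have "weakly_tendsto (f i) ((c(j := d)) i) G'" if "i \<in> insert j I" for i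
    using that G' G(3) by (cases "i = j") (auto intro: weakly_tendsto_mono[OF _ G'(1)])
  then show ?case using G' G(1) by (meson order_trans)
qed auto

text \<open>The subsequence principle for filters: if \<open>f\<close> frequently leaves a
  neighbourhood of \<open>l\<close>, then restricting \<open>F\<close> to those indices gives a
  proper filter with no proper subfilter along which \<open>f\<close> tends to
  \<open>l\<close>.\<close>

lemma tendsto_if_subfilters:
  assumes "\<And>G. G \<le> F \<Longrightarrow> G \<noteq> bot \<Longrightarrow> \<exists>G'\<le>G. G' \<noteq> bot \<and> (f \<longlongrightarrow> l) G'"
  shows "(f \<longlongrightarrow> l) F"
proof (rule topological_tendstoI, rule ccontr)
  fix S assume S: "open S" "l \<in> S" "\<not> (\<forall>\<^sub>F k in F. f k \<in> S)"
  define G where "G = inf F (principal {k. f k \<notin> S})"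
  have "G \<noteq> bot" using S(3) by (simp add: G_def trivial_limit_def eventually_inf_principal)
  then obtain G' where G': "G' \<le> G" "G' \<noteq> bot" "(f \<longlongrightarrow> l) G'"
    using assms[of G] by (auto simp: G_def)
  have "eventually (\<lambda>k. f k \<notin> S) G" by (simp add: G_def eventually_inf_principal)
  then have "eventually (\<lambda>k. f k \<notin> S) G'" using G'(1) filter_leD by blast
  moreover have "eventually (\<lambda>k. f k \<in> S) G'" using G'(3) S by (simp add: tendsto_def)
  ultimately have "eventually (\<lambda>_. False) G'" by eventually_elim simp
  then show False using G'(2) by (simp add: trivial_limit_def)
qed

text \<open>Closed balls are weakly closed; testing against \<open>c - p\<close> itself and
  cancelling one factor \<open>norm (c - p)\<close> shows it.\<close>

lemma weakly_tendsto_norm_le: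
  assumes G: "G \<noteq> bot" and f: "weakly_tendsto f c G" and le: "\<forall>\<^sub>F k in G. norm (f k - p) \<le> r"
  shows "norm (c - p) \<le> r"
proof (cases "c = p")
  case True
  have "\<exists>k. norm (f k - p) \<le> r" using eventually_happens'[OF G le] .
  then show ?thesis using True norm_ge_zero by (metis diff_self norm_zero order_trans)
next
  case False
  have "((\<lambda>k. inner (f k) (c - p) - inner p (c - p)) \<longlongrightarrow> inner c (c - p) - inner p (c - p)) G"
    by (intro tendsto_diff weakly_tendstoD f tendsto_const)
  moreover have "\<forall>\<^sub>F k in G. inner (f k) (c - p) - inner p (c - p) \<le> r * norm (c - p)"
    using le
  proof eventually_elim
    case (elim k)
    then show ?case
      using norm_cauchy_schwarz[of "f k - p" "c - p"] mult_right_mono[OF elim norm_ge_zero[of "c - p"]]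
      by (simp add: inner_diff_left)
  qed
  ultimately have "inner c (c - p) - inner p (c - p) \<le> r * norm (c - p)"
    using tendsto_upperbound G by blast
  then have "norm (c - p) * norm (c - p) \<le> r * norm (c - p)"
    by (simp flip: power2_norm_eq_inner power2_eq_square inner_diff_left)
  then show ?thesis using False by simp
qed

section \<open>Minty's theorem\<close>

text \<open>The variance identity for weights of total mass 1. It converts a comparison of pairwise
  distances into a comparison of variances.\<close>

lemma sum_sum_norm_diff_power2:
  fixes p :: "'b \<Rightarrow> 'a::real_inner"
  assumes "sum \<mu> S = 1"
  shows "(\<Sum>a\<in>S. \<Sum>b\<in>S. \<mu> a * \<mu> b * (norm (p a - p b))\<^sup>2)
    = 2 * (\<Sum>a\<in>S. \<mu> a * (norm (p a))\<^sup>2) - 2 * (norm (\<Sum>a\<in>S. \<mu> a *\<^sub>R p a))\<^sup>2"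
proof -
  have "(\<Sum>a\<in>S. \<Sum>b\<in>S. \<mu> a * \<mu> b * (norm (p a - p b))\<^sup>2)
    = (\<Sum>a\<in>S. \<Sum>b\<in>S. \<mu> a * (norm (p a))\<^sup>2 * \<mu> b) + (\<Sum>a\<in>S. \<Sum>b\<in>S. \<mu> a * (\<mu> b * (norm (p b))\<^sup>2))
      - 2 * (\<Sum>a\<in>S. \<Sum>b\<in>S. inner (\<mu> a *\<^sub>R p a) (\<mu> b *\<^sub>R p b))"
    unfolding sum_distrib_left sum.distrib[symmetric] sum_subtractf[symmetric]
    by (intro sum.cong refl) (simp add: power2_norm_eq_inner inner_diff_left inner_diff_right
        inner_commute algebra_simps)
  also have "(\<Sum>a\<in>S. \<Sum>b\<in>S. \<mu> a * (norm (p a))\<^sup>2 * \<mu> b) = (\<Sum>a\<in>S. \<mu> a * (norm (p a))\<^sup>2)"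
    by (simp add: assms flip: sum_distrib_left)
  also have "(\<Sum>a\<in>S. \<Sum>b\<in>S. \<mu> a * (\<mu> b * (norm (p b))\<^sup>2)) = (\<Sum>a\<in>S. \<mu> a * (norm (p a))\<^sup>2)"
    by (simp add: assms flip: sum_distrib_left sum_distrib_right)
  also have "(\<Sum>a\<in>S. \<Sum>b\<in>S. inner (\<mu> a *\<^sub>R p a) (\<mu> b *\<^sub>R p b)) = (norm (\<Sum>a\<in>S. \<mu> a *\<^sub>R p a))\<^sup>2"
    unfolding power2_norm_eq_inner inner_sum_left inner_sum_right by (rule sum.swap)
  finally show ?thesis by simp
qed

text \<open>By hypothesis \<open>snd a\<close> is mapped to \<open>fst a\<close> by a nonexpansive
  map; the point \<open>x\<close> is an admissible value for this map at the origin.\<close>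

lemma Kirszbraun_one_point_finite:
  fixes P :: "('a::real_inner \<times> 'a) set"
  assumes fin: "finite P"
    and P: "\<And>a b. a \<in> P \<Longrightarrow> b \<in> P \<Longrightarrow> norm (fst a - fst b) \<le> norm (snd a - snd b)"
  shows "\<exists>x. \<forall>a\<in>P. norm (x - fst a) \<le> norm (snd a)"
proof (cases "P = {}")
  case False
  \<comment> \<open>Lagrangian dual of minimising \<open>max\<^sub>a (\<parallel>x - fst a\<parallel>\<^sup>2 - \<parallel>snd a\<parallel>\<^sup>2)\<close>: first-order optimality of a dual
    maximiser \<open>(s, t)\<close> bounds every constraint at \<open>s\<close> by the dual value \<open>t - \<parallel>s\<parallel>\<^sup>2\<close>.\<close>
  define e where "e a = (norm (fst a))\<^sup>2 - (norm (snd a))\<^sup>2" for a :: "'a \<times> 'a"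
  define K where "K = convex hull ((\<lambda>a. (fst a, e a)) ` P)"
  have "compact K" "K \<noteq> {}"
    using fin False by (auto simp: K_def intro!: finite_imp_compact_convex_hull)
  moreover have "continuous_on K (\<lambda>y. snd y - (norm (fst y))\<^sup>2)"
    by (intro continuous_intros)
  ultimately obtain y where "y \<in> K"
    and max: "\<And>w. w \<in> K \<Longrightarrow> snd w - (norm (fst w))\<^sup>2 \<le> snd y - (norm (fst y))\<^sup>2"
    using continuous_attains_sup[of K] by blast
  define s t where "s = fst y" and "t = snd y"
  have y: "y = (s, t)" by (simp add: s_def t_def)
  \<comment> \<open>The dual value is nonpositive: the weighted variance of the \<open>fst a\<close>
    is at most that of the \<open>snd a\<close>, and rearranging bounds
    \<open>t - (norm s)^2\<close> by minus the squared norm of the mean of the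
    \<open>snd a\<close>.\<close>
  have t_le: "t \<le> (norm s)\<^sup>2"
  proof -
    \<comment> \<open>Convex weights come indexed by image points, and distinct pairs may share an
      image. Choosing one representative for each image lets the weights be indexed by
      pairs.\<close>
    obtain Q where "Q \<subseteq> P" and inj: "inj_on (\<lambda>a. (fst a, e a)) Q"
      and Q: "(\<lambda>a. (fst a, e a)) ` P = (\<lambda>a. (fst a, e a)) ` Q"
      using subset_image_inj[of "(\<lambda>a. (fst a, e a)) ` P" "\<lambda>a. (fst a, e a)" P] by auto
    then have "finite ((\<lambda>a. (fst a, e a)) ` Q)" using fin finite_subset by blast
    moreover have "y \<in> convex hull ((\<lambda>a. (fst a, e a)) ` Q)" using \<open>y \<in> K\<close> unfolding K_def Q .
    ultimately obtain \<nu> where "\<And>b. b \<in> (\<lambda>a. (fst a, e a)) ` Q \<Longrightarrow> 0 \<le> \<nu> b"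
      and "sum \<nu> ((\<lambda>a. (fst a, e a)) ` Q) = 1" "(\<Sum>b\<in>(\<lambda>a. (fst a, e a)) ` Q. \<nu> b *\<^sub>R b) = y"
      by (simp only: convex_hull_finite) blast
    then obtain \<mu> where \<mu>: "\<And>a. a \<in> Q \<Longrightarrow> 0 \<le> \<mu> a" "sum \<mu> Q = 1"
      and "(\<Sum>a\<in>Q. \<mu> a *\<^sub>R (fst a, e a)) = y"
      using that[of "\<lambda>a. \<nu> (fst a, e a)"] inj by (simp add: sum.reindex)
    then have s: "s = (\<Sum>a\<in>Q. \<mu> a *\<^sub>R fst a)" and t: "t = (\<Sum>a\<in>Q. \<mu> a * e a)"
      by (auto simp: s_def t_def fst_sum snd_sum)
    have "(\<Sum>a\<in>Q. \<Sum>b\<in>Q. \<mu> a * \<mu> b * (norm (fst a - fst b))\<^sup>2)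
      \<le> (\<Sum>a\<in>Q. \<Sum>b\<in>Q. \<mu> a * \<mu> b * (norm (snd a - snd b))\<^sup>2)"
      using \<open>Q \<subseteq> P\<close>
      by (intro sum_mono mult_left_mono power_mono P mult_nonneg_nonneg \<mu>) auto
    then have "(\<Sum>a\<in>Q. \<mu> a * (norm (fst a))\<^sup>2) - (norm s)\<^sup>2
        \<le> (\<Sum>a\<in>Q. \<mu> a * (norm (snd a))\<^sup>2) - (norm (\<Sum>a\<in>Q. \<mu> a *\<^sub>R snd a))\<^sup>2"
      unfolding sum_sum_norm_diff_power2[OF \<mu>(2)] s by simp
    then have "t + (norm (\<Sum>a\<in>Q. \<mu> a *\<^sub>R snd a))\<^sup>2 \<le> (norm s)\<^sup>2"
      by (simp add: t e_def right_diff_distrib sum_subtractf)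
    then show ?thesis using zero_le_power2 by (smt (verit))
  qed
  have "norm (s - fst a) \<le> norm (snd a)" if "a \<in> P" for a
  proof -
    have *: "e a - t - 2 * inner s (fst a - s) \<le> 0"
    proof (rule ccontr)
      define d where "d = e a - t - 2 * inner s (fst a - s)"
      assume "\<not> ?thesis"
      then have "d > 0" by (simp add: d_def)
      define r where "r = (norm (fst a - s))\<^sup>2"
      have "r \<ge> 0" by (simp add: r_def)
      \<comment> \<open>A short move from the optimum towards the vertex of \<open>a\<close>:
        optimality yields \<open>d \<le> \<theta> * r\<close>, and this \<open>\<theta>\<close> is
        small enough for \<open>\<theta> * r < d\<close>.\<close>
      define \<theta> where "\<theta> = d / (d + r + 1)"
      have \<theta>: "0 < \<theta>" "\<theta> \<le> 1" using \<open>d > 0\<close> \<open>r \<ge> 0\<close> by (auto simp: \<theta>_def field_simps)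
      have "(fst a, e a) \<in> K" unfolding K_def using that by (auto intro: hull_inc)
      then have "(1 - \<theta>) *\<^sub>R y + \<theta> *\<^sub>R (fst a, e a) \<in> K"
        using \<open>y \<in> K\<close> \<theta> convex_convex_hull unfolding K_def by (intro convexD_alt) auto
      then have "(t + \<theta> * (e a - t)) - (norm (s + \<theta> *\<^sub>R (fst a - s)))\<^sup>2 \<le> t - (norm s)\<^sup>2"
        using max[of "(1 - \<theta>) *\<^sub>R y + \<theta> *\<^sub>R (fst a, e a)"]
        by (simp add: y algebra_simps)
      moreover have "(norm (s + \<theta> *\<^sub>R (fst a - s)))\<^sup>2
          = (norm s)\<^sup>2 + 2 * \<theta> * inner s (fst a - s) + \<theta>\<^sup>2 * r"
        unfolding r_def power2_norm_eq_inner
        by (simp add: inner_simps inner_commute algebra_simps power2_eq_square)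
      ultimately have "\<theta> * d \<le> \<theta> * (\<theta> * r)"
        by (simp add: d_def algebra_simps power2_eq_square)
      then have "d \<le> \<theta> * r" using \<theta>(1) by simp
      also have "\<dots> < d"
        using \<open>d > 0\<close> \<open>r \<ge> 0\<close> by (simp add: \<theta>_def pos_divide_less_eq)
      finally show False by simp
    qed
    have "(norm (s - fst a))\<^sup>2 = (norm (fst a))\<^sup>2 - 2 * inner s (fst a - s) - (norm s)\<^sup>2"
      unfolding power2_norm_eq_inner by (simp add: inner_simps inner_commute algebra_simps)
    then have "(norm (s - fst a))\<^sup>2 \<le> (norm (snd a))\<^sup>2"
      using * t_le by (simp add: e_def)
    then show ?thesis by (rule power2_le_imp_le) simp
  qed
  then show ?thesis by blast
qed auto

text \<open>Solutions for the finite subsets are bounded once a fixed \<open>a0\<close> is included.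
  A weak cluster point along growing finite subsets stays in every ball, since each ball condition
  holds eventually and balls are weakly closed.\<close>

lemma Kirszbraun_one_point:
  fixes P :: "('a::{real_inner, complete_space} \<times> 'a) set"
  assumes P: "\<And>a b. a \<in> P \<Longrightarrow> b \<in> P \<Longrightarrow> norm (fst a - fst b) \<le> norm (snd a - snd b)"
  shows "\<exists>x. \<forall>a\<in>P. norm (x - fst a) \<le> norm (snd a)"
proof (cases "P = {}")
  case False
  then obtain a0 where "a0 \<in> P" by blast
  have "\<exists>x. \<forall>a\<in>Q. norm (x - fst a) \<le> norm (snd a)" if "finite Q" "Q \<subseteq> P" for Q
    using Kirszbraun_one_point_finite[of Q] that P by blast
  then obtain f where f: "\<And>Q a. finite Q \<Longrightarrow> Q \<subseteq> P \<Longrightarrow> a \<in> Q \<Longrightarrow> norm (f Q - fst a) \<le> norm (snd a)"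
    by metis
  define F where "F = finite_subsets_at_top P"
  have ball: "\<forall>\<^sub>F Q in F. norm (f Q - fst a) \<le> norm (snd a)" if "a \<in> P" for a
    unfolding F_def eventually_finite_subsets_at_top
    using that f by (intro exI[of _ "{a}"]) auto
  have "\<forall>\<^sub>F Q in F. norm (f Q) \<le> norm (snd a0) + norm (fst a0)"
    using ball[OF \<open>a0 \<in> P\<close>]
  proof eventually_elim
    case (elim Q)
    then show ?case using norm_triangle_sub[of "f Q" "fst a0"] by simp
  qed
  moreover have "F \<noteq> bot" by (simp add: F_def finite_subsets_at_top_neq_bot)
  ultimately obtain G c where G: "G \<le> F" "G \<noteq> bot" "weakly_tendsto f c G"
    using bounded_weak_cluster_point by blast
  have "norm (c - fst a) \<le> norm (snd a)" if "a \<in> P" for a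
    using weakly_tendsto_norm_le[OF G(2,3)] ball[OF that] G(1) filter_leD by blast
  then show ?thesis by blast
qed auto

text \<open>By maximality it is enough that \<open>(x, (1 / lam) *\<^sub>R (u - x))\<close> be
  monotonically related to every point of the graph. Each such relation is a ball condition on
  \<open>x\<close>, and monotonicity of \<open>A\<close> is, by polarization, the distance
  hypothesis that makes the balls meet.\<close>

lemma Minty:
  fixes A :: "'a::{real_inner, complete_space} \<Rightarrow> 'a set"
  assumes A: "maximally_monotone A" and lam: "lam > 0"
  shows "\<exists>x. (1 / lam) *\<^sub>R (u - x) \<in> A x"
proof -
  have mono: "inner (y - y') (v - v') \<ge> 0" if "v \<in> A y" "v' \<in> A y'" for y y' v v'
    using A that unfolding maximally_monotone_def monotone_op_def by blast
  \<comment> \<open>\<open>\<langle>x - y, x + lam v - u\<rangle> \<le> 0\<close> says that \<open>x\<close> lies in the ball whose centre and radius vector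
    form this pair.\<close>
  define P where "P = {((1/2) *\<^sub>R (y + u - lam *\<^sub>R v), (1/2) *\<^sub>R (y - u + lam *\<^sub>R v)) | y v. v \<in> A y}"
  have polarization: "(norm ((1/2) *\<^sub>R (b + a)))\<^sup>2 - (norm ((1/2) *\<^sub>R (b - a)))\<^sup>2 = inner b a" for a b :: 'a
    unfolding power2_norm_eq_inner by (simp add: inner_simps inner_commute algebra_simps)
  have "norm (fst a - fst b) \<le> norm (snd a - snd b)" if ab: "a \<in> P" "b \<in> P" for a b
  proof -
    obtain y v where a:
      "v \<in> A y" "a = ((1/2) *\<^sub>R (y + u - lam *\<^sub>R v), (1/2) *\<^sub>R (y - u + lam *\<^sub>R v))"
      using ab(1) unfolding P_def by auto
    obtain y' v' where b:
      "v' \<in> A y'" "b = ((1/2) *\<^sub>R (y' + u - lam *\<^sub>R v'), (1/2) *\<^sub>R (y' - u + lam *\<^sub>R v'))"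
      using ab(2) unfolding P_def by auto
    have diffs: "fst a - fst b = (1/2) *\<^sub>R ((y - y') - lam *\<^sub>R (v - v'))"
      "snd a - snd b = (1/2) *\<^sub>R ((y - y') + lam *\<^sub>R (v - v'))"
      using a b by (simp_all add: algebra_simps)
    have "inner (y - y') (lam *\<^sub>R (v - v')) \<ge> 0"
      using mono[OF a(1) b(1)] lam by simp
    then have "(norm (fst a - fst b))\<^sup>2 \<le> (norm (snd a - snd b))\<^sup>2"
      unfolding diffs using polarization[of "y - y'" "lam *\<^sub>R (v - v')"] by linarith
    then show ?thesis by (rule power2_le_imp_le) simp
  qed
  then have "\<exists>x. \<forall>a\<in>P. norm (x - fst a) \<le> norm (snd a)" by (rule Kirszbraun_one_point)
  then obtain x where x: "\<And>a. a \<in> P \<Longrightarrow> norm (x - fst a) \<le> norm (snd a)" by blast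
  define w where "w = (1 / lam) *\<^sub>R (u - x)"
  have rel: "inner (x - y) (w - v) \<ge> 0" if "v \<in> A y" for y v
  proof -
    have "norm (x - (1/2) *\<^sub>R (y + u - lam *\<^sub>R v)) \<le> norm ((1/2) *\<^sub>R (y - u + lam *\<^sub>R v))"
      using x that unfolding P_def by fastforce
    then have "(norm (x - (1/2) *\<^sub>R (y + u - lam *\<^sub>R v)))\<^sup>2 \<le> (norm ((1/2) *\<^sub>R (y - u + lam *\<^sub>R v)))\<^sup>2"
      by (simp add: power_mono)
    then have "(norm ((1/2) *\<^sub>R ((x - y) + (x + lam *\<^sub>R v - u))))\<^sup>2
        \<le> (norm ((1/2) *\<^sub>R ((x - y) - (x + lam *\<^sub>R v - u))))\<^sup>2"
      by (simp add: power2_norm_eq_inner inner_simps inner_commute algebra_simps)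
    then have "inner (x - y) (x + lam *\<^sub>R v - u) \<le> 0"
      using polarization[of "x - y" "x + lam *\<^sub>R v - u"] by linarith
    moreover have "x + lam *\<^sub>R v - u = - lam *\<^sub>R (w - v)"
      using lam by (simp add: w_def algebra_simps)
    ultimately show ?thesis using lam by (simp add: zero_le_mult_iff)
  qed
  have "w \<in> A x"
  proof (rule ccontr)
    assume "w \<notin> A x"
    define A' where "A' = A(x := insert w (A x))"
    have "monotone_op A'"
      unfolding monotone_op_def
    proof (intro allI ballI)
      fix y y' v v' assume "v \<in> A' y" "v' \<in> A' y'"
      then consider "v \<in> A y" "v' \<in> A y'" | "v \<in> A y" "y' = x" "v' = w"
        | "y = x" "v = w" "v' \<in> A y'" | "y = y'"
        by (auto simp: A'_def split: if_splits)
      then show "inner (y - y') (v - v') \<ge> 0"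
      proof cases
        case 2
        then show ?thesis using rel[of v y] by (metis inner_minus_left inner_minus_right minus_diff_eq minus_minus)
      qed (use mono rel in auto)
    qed
    moreover have "graph_op A \<subset> graph_op A'"
      using \<open>w \<notin> A x\<close> by (auto simp: graph_op_def A'_def)
    ultimately show False using A unfolding maximally_monotone_def by blast
  qed
  then show ?thesis unfolding w_def by blast
qed

text \<open>Minty gives existence and monotonicity gives uniqueness, so \<open>the_elem\<close> is
  applied to a singleton. From here on resolvents are handled as inclusions.\<close>

lemma resolvent_eq_iff:
  fixes A :: "'a::{real_inner, complete_space} \<Rightarrow> 'a set"
  assumes A: "maximally_monotone A" and lam: "lam > 0"
  shows "resolvent lam A u = x \<longleftrightarrow> (1 / lam) *\<^sub>R (u - x) \<in> A x"
proof -
  have inv: "inverse_op (\<lambda>x. (\<lambda>v. x + lam *\<^sub>R v) ` A x) u = {y. (1 / lam) *\<^sub>R (u - y) \<in> A y}"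
    using lam by (force simp: inverse_op_def image_iff)
  have unique: "y = y'" if "(1 / lam) *\<^sub>R (u - y) \<in> A y" "(1 / lam) *\<^sub>R (u - y') \<in> A y'" for y y'
  proof -
    have "0 \<le> inner (y - y') ((1 / lam) *\<^sub>R (u - y) - (1 / lam) *\<^sub>R (u - y'))"
      using A that unfolding maximally_monotone_def monotone_op_def by blast
    also have "(1 / lam) *\<^sub>R (u - y) - (1 / lam) *\<^sub>R (u - y') = - (1 / lam) *\<^sub>R (y - y')"
      by (simp add: algebra_simps)
    finally have "inner (y - y') (y - y') \<le> 0"
      using lam by (simp add: divide_le_0_iff zero_le_divide_iff)
    then show ?thesis by (metis inner_ge_zero inner_eq_zero_iff order_antisym right_minus_eq)
  qed
  obtain y where "(1 / lam) *\<^sub>R (u - y) \<in> A y" using Minty[OF A lam] by blast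
  then have "inverse_op (\<lambda>x. (\<lambda>v. x + lam *\<^sub>R v) ` A x) u = {y}" unfolding inv using unique by blast
  then have "resolvent lam A u = y" by (simp add: resolvent_def)
  then show ?thesis using \<open>(1 / lam) *\<^sub>R (u - y) \<in> A y\<close> unique by blast
qed

text \<open>A solution is a fixed point of \<open>resolvent lam A (u - lam *\<^sub>R B x)\<close> as
  a map of \<open>x\<close>, which is a contraction with factor \<open>lam * L\<close>. It yields
  the test points in the demiclosedness argument.\<close>

lemma resolvent_surj_Lipschitz_sum:
  fixes A :: "'a::{real_inner, complete_space} \<Rightarrow> 'a set"
  assumes A: "maximally_monotone A" and lam: "lam > 0"
    and B: "L-lipschitz_on UNIV B" and "lam * L < 1"
  shows "\<exists>x. (1 / lam) *\<^sub>R (u - x) - B x \<in> A x"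
proof -
  define f where "f x = resolvent lam A (u - lam *\<^sub>R B x)" for x
  have f: "(1 / lam) *\<^sub>R (u - f x) - B x \<in> A (f x)" for x
    using resolvent_eq_iff[OF A lam, of "u - lam *\<^sub>R B x" "f x"] lam
    by (simp add: f_def algebra_simps)
  have "\<exists>!x. f x = x"
  proof (rule banach_fix_type[of "lam * L"])
    show "0 \<le> lam * L" using lam lipschitz_on_nonneg[OF B] by simp
    show "lam * L < 1" by fact
    show "\<forall>x y. dist (f x) (f y) \<le> lam * L * dist x y"
    proof (intro allI)
      fix x y
      have "0 \<le> lam * inner (f x - f y) (((1 / lam) *\<^sub>R (u - f x) - B x) - ((1 / lam) *\<^sub>R (u - f y) - B y))"
        using A f lam unfolding maximally_monotone_def monotone_op_def by simp
      also have "\<dots> = inner (f x - f y) (lam *\<^sub>R (((1 / lam) *\<^sub>R (u - f x) - B x) - ((1 / lam) *\<^sub>R (u - f y) - B y)))"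
        by simp
      also have "lam *\<^sub>R (((1 / lam) *\<^sub>R (u - f x) - B x) - ((1 / lam) *\<^sub>R (u - f y) - B y))
          = lam *\<^sub>R (B y - B x) - (f x - f y)"
        using lam by (simp add: algebra_simps)
      finally have "(norm (f x - f y))\<^sup>2 \<le> lam * inner (f x - f y) (B y - B x)"
        by (simp add: inner_diff_right power2_norm_eq_inner)
      also have "\<dots> \<le> lam * (norm (f x - f y) * (L * norm (x - y)))"
        using norm_cauchy_schwarz[of "f x - f y" "B y - B x"] lipschitz_onD[OF B, of y x] lam
        by (intro mult_left_mono)
          (auto simp: dist_norm norm_minus_commute elim!: order_trans intro: mult_left_mono)
      finally have "norm (f x - f y) * norm (f x - f y) \<le> norm (f x - f y) * (lam * L * norm (x - y))"
        by (simp add: power2_eq_square algebra_simps)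
      then show "dist (f x) (f y) \<le> lam * L * dist x y"
        using \<open>0 \<le> lam * L\<close> by (cases "f x = f y") (auto simp: dist_norm)
    qed
  qed
  then show ?thesis using f by metis
qed

section \<open>The splitting on a ring\<close>

lemma tendsto_inner_bounded_null:
  fixes f g :: "'b \<Rightarrow> 'a::real_inner"
  assumes "\<forall>\<^sub>F k in F. norm (f k) \<le> M" and "(g \<longlongrightarrow> 0) F"
  shows "((\<lambda>k. inner (f k) (g k)) \<longlongrightarrow> 0) F"
proof (rule Lim_null_comparison)
  show "\<forall>\<^sub>F k in F. norm (inner (f k) (g k)) \<le> M * norm (g k)"
    using assms(1)
  proof eventually_elim
    case (elim k)
    then show ?case
      using Cauchy_Schwarz_ineq2[of "f k" "g k"] by (auto elim!: order_trans intro: mult_right_mono)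
  qed
  show "((\<lambda>k. M * norm (g k)) \<longlongrightarrow> 0) F"
    using tendsto_mult_left[OF tendsto_norm_zero[OF assms(2)], of M] by simp
qed

text \<open>Here \<open>e\<close> and \<open>w\<close> will be the errors of x and z, and
  \<open>F\<close> the scaled jumps. The products telescope up to sums over increments of
  \<open>e\<close>, and polarization of the quadratic part leaves half of each squared increment. At
  \<open>i = 0\<close> truncated subtraction reads \<open>F 0\<close>, which is 0.\<close>

lemma sum_inner_by_parts:
  fixes e w F :: "nat \<Rightarrow> 'a::real_inner"
  assumes "F 0 = 0"
  shows "(\<Sum>i<m. inner (e (Suc i)) (w (Suc i) - w i - (e (Suc i) - e i) + F i - F (i - 1)))
    = inner (e m) (w m) - inner (e 0) (w 0) - (norm (e m))\<^sup>2 / 2 + (norm (e 0))\<^sup>2 / 2 + inner (e m) (F (m - 1))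
      - (\<Sum>i<m. inner (e (Suc i) - e i) (w i)) - (\<Sum>i<m. (norm (e (Suc i) - e i))\<^sup>2) / 2
      - (\<Sum>i<m. inner (e (Suc i) - e i) (F (i - 1)))"
proof (induction m)
  case (Suc m)
  have "inner (e (Suc m)) (w (Suc m) - w m - (e (Suc m) - e m) + F m - F (m - 1))
    = inner (e (Suc m)) (w (Suc m)) - inner (e m) (w m)
      - (norm (e (Suc m)))\<^sup>2 / 2 + (norm (e m))\<^sup>2 / 2
      + inner (e (Suc m)) (F m) - inner (e m) (F (m - 1))
      - inner (e (Suc m) - e m) (w m) - (norm (e (Suc m) - e m))\<^sup>2 / 2
      - inner (e (Suc m) - e m) (F (m - 1))"
    unfolding power2_norm_eq_inner by (simp add: inner_simps inner_commute field_simps)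
  with Suc show ?case by (simp add: add_divide_distrib)
qed (simp add: assms)

section \<open>The resolvent equations in uniform shape\<close>

text \<open>Only the operators and \<open>lam\<close> are fixed. The relaxation parameter and the
  sequences enter lemma by lemma, so that iterates and fixed points are treated by the same
  facts.\<close>

locale ring_splitting =
  fixes n :: nat and L lam :: real
    and A :: "nat \<Rightarrow> 'a::{real_inner, complete_space} \<Rightarrow> 'a set"
    and B :: "nat \<Rightarrow> 'a \<Rightarrow> 'a"
  assumes n: "n \<ge> 3"
    and L: "L > 0"
    and A: "\<And>i. i \<in> {1..n} \<Longrightarrow> maximally_monotone (A i)"
    and B_mono: "\<And>i. i \<in> {1..n-2} \<Longrightarrow> monotone_op (\<lambda>y. {B i y})"
    and B_lip: "\<And>i. i \<in> {1..n-2} \<Longrightarrow> L-lipschitz_on UNIV (B i)"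
    and lam: "0 < lam" "2 * lam * L < 1"
begin

definition B0 :: "nat \<Rightarrow> 'a \<Rightarrow> 'a" where
  "B0 i = (if i \<in> {1..n-2} then B i else (\<lambda>_. 0))"

definition jump :: "(nat \<Rightarrow> 'a) \<Rightarrow> nat \<Rightarrow> 'a" where
  "jump x i = B0 i (x (Suc i)) - B0 i (x i)"

definition dual_point :: "(nat \<Rightarrow> 'a) \<Rightarrow> (nat \<Rightarrow> 'a) \<Rightarrow> nat \<Rightarrow> 'a" where
  "dual_point z x i = (1 / lam) *\<^sub>R (z (Suc i) - z i - (x (Suc i) - x i)) + jump x i - jump x (i - 1)"

text \<open>A relation instead of a recursion: an iterate and a fixed point are both instances, and
  monotonicity compares any two of them. The values at 0 and \<open>n\<close> close the chain into a
  ring, which makes all \<open>n\<close> inclusions alike.\<close>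

definition splitting :: "(nat \<Rightarrow> 'a) \<Rightarrow> (nat \<Rightarrow> 'a) \<Rightarrow> bool" where
  "splitting z x \<longleftrightarrow> x 0 = x 1 \<and> z 0 = x 1 \<and> z n = x 1 \<and>
    (\<forall>i<n. dual_point z x i - B0 i (x (Suc i)) \<in> A (Suc i) (x (Suc i)))"

lemma B0_0 [simp]: "B0 0 x = 0" and B0_last [simp]: "B0 (n - Suc 0) x = 0"
  using n by (auto simp: B0_def)

lemma jump_0 [simp]: "jump x 0 = 0" and jump_last [simp]: "jump x (n - Suc 0) = 0"
  by (simp_all add: jump_def)

lemma jump_const [simp]: "jump (\<lambda>_. p) i = 0"
  by (simp add: jump_def)

lemma B0_lip: "norm (B0 i x - B0 i y) \<le> L * norm (x - y)"
  using lipschitz_onD[OF B_lip[of i], of x y] L by (auto simp: B0_def dist_norm)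

lemma norm_jump_le: "norm (jump x i) \<le> L * norm (x (Suc i) - x i)"
  unfolding jump_def by (rule B0_lip)

lemma monotone_A:
  "i < n \<Longrightarrow> u \<in> A (Suc i) x \<Longrightarrow> v \<in> A (Suc i) y \<Longrightarrow> inner (x - y) (u - v) \<ge> 0"
  using A[of "Suc i"] unfolding maximally_monotone_def monotone_op_def by auto

lemma monotone_sum:
  assumes "i < n" "u - B0 i x \<in> A (Suc i) x" "v - B0 i y \<in> A (Suc i) y"
  shows "inner (x - y) (u - v) \<ge> 0"
proof -
  have "inner (x - y) (B0 i x - B0 i y) \<ge> 0"
    using B_mono[of i] unfolding monotone_op_def by (auto simp: B0_def)
  moreover have "inner (x - y) ((u - B0 i x) - (v - B0 i y)) \<ge> 0"
    using assms by (rule monotone_A)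
  ultimately show ?thesis by (simp add: inner_diff_right)
qed

text \<open>The explicit value of \<open>B0 i\<close> at \<open>x i\<close> is traded for its value
  at \<open>x (Suc i)\<close> plus a jump. Then \<open>A (Suc i)\<close> and \<open>B0 i\<close> are
  evaluated at the same point and their monotonicity can be added.\<close>

lemma splitting_iff_resolvent:
  "splitting z x \<longleftrightarrow> x 0 = x 1 \<and> z 0 = x 1 \<and> z n = x 1 \<and>
    (\<forall>i<n. x (Suc i) = resolvent lam (A (Suc i))
      (z (Suc i) + x i - z i - lam *\<^sub>R B0 i (x i) - lam *\<^sub>R jump x (i - 1)))"
proof -
  have "(\<forall>i<n. x (Suc i) = resolvent lam (A (Suc i))
      (z (Suc i) + x i - z i - lam *\<^sub>R B0 i (x i) - lam *\<^sub>R jump x (i - 1)))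
    \<longleftrightarrow> (\<forall>i<n. dual_point z x i - B0 i (x (Suc i)) \<in> A (Suc i) (x (Suc i)))"
  proof (intro all_cong)
    fix i assume "i < n"
    let ?u = "z (Suc i) + x i - z i - lam *\<^sub>R B0 i (x i) - lam *\<^sub>R jump x (i - 1)"
    have "x (Suc i) = resolvent lam (A (Suc i)) ?u \<longleftrightarrow> resolvent lam (A (Suc i)) ?u = x (Suc i)"
      by (rule eq_commute)
    also have "\<dots> \<longleftrightarrow> (1 / lam) *\<^sub>R (?u - x (Suc i)) \<in> A (Suc i) (x (Suc i))"
      using A \<open>i < n\<close> lam(1) by (intro resolvent_eq_iff) auto
    also have "(1 / lam) *\<^sub>R (?u - x (Suc i)) = dual_point z x i - B0 i (x (Suc i))"
      using lam(1) unfolding dual_point_def jump_def[of x i] by (simp add: algebra_simps)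
    finally show "x (Suc i) = resolvent lam (A (Suc i)) ?u
        \<longleftrightarrow> dual_point z x i - B0 i (x (Suc i)) \<in> A (Suc i) (x (Suc i))" .
  qed
  then show ?thesis by (simp only: splitting_def)
qed

text \<open>For \<open>i = 0\<close> the boundary values cancel and leave \<open>x 1\<close> as the
  resolvent of \<open>z 1\<close>. This fixes \<open>z 0\<close> and \<open>z n\<close>, after which
  the equations determine the remaining components successively.\<close>

lemma splitting_unique:
  assumes z: "\<And>i. i \<in> {1..<n} \<Longrightarrow> z i = z' i"
    and x: "splitting z x" and x': "splitting z' x'"
  shows "i \<le> n \<Longrightarrow> x i = x' i"
proof -
  have resolvent_x: "x (Suc i) = resolvent lam (A (Suc i))
      (z (Suc i) + x i - z i - lam *\<^sub>R B0 i (x i) - lam *\<^sub>R jump x (i - 1))"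
    and resolvent_x': "x' (Suc i) = resolvent lam (A (Suc i))
      (z' (Suc i) + x' i - z' i - lam *\<^sub>R B0 i (x' i) - lam *\<^sub>R jump x' (i - 1))" if "i < n" for i
    using x x' that unfolding splitting_iff_resolvent by blast+
  have bd: "x 0 = x 1" "z 0 = x 1" "z n = x 1" "x' 0 = x' 1" "z' 0 = x' 1" "z' n = x' 1"
    using x x' by (auto simp: splitting_def)
  have "resolvent lam (A 1) (z 1) = x 1" "resolvent lam (A 1) (z' 1) = x' 1"
    using resolvent_x[of 0] resolvent_x'[of 0] n bd by simp_all
  then have x1: "x 1 = x' 1" using z[of 1] n by simp
  have z_eq: "i \<le> n \<Longrightarrow> z i = z' i" for i
    using bd x1 z[of i] by (cases "i = 0 \<or> i = n") auto
  show "i \<le> n \<Longrightarrow> x i = x' i"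
  proof (induction i rule: less_induct)
    case (less i)
    show ?case
    proof (cases i)
      case 0
      then show ?thesis using bd x1 by simp
    next
      case (Suc j)
      then have "jump x (j - 1) = jump x' (j - 1)"
        using less by (cases j) (auto simp: jump_def)
      moreover have "x j = x' j" "z j = z' j" "z (Suc j) = z' (Suc j)"
        using Suc less z_eq by auto
      ultimately show ?thesis
        using Suc less.prems unfolding Suc by (subst resolvent_x, simp, subst resolvent_x', simp_all)
    qed
  qed
qed

lemma splittingI:
  assumes x_1: "x 1 = resolvent lam (A 1) (z 1)"
    and x_2: "x 2 = resolvent lam (A 2) (z 2 + x 1 - z 1 - lam *\<^sub>R B 1 (x 1))"
    and x_i: "\<And>i. i \<in> {3..n-1} \<Longrightarrow> x i = resolvent lam (A i)
        (z i + x (i - 1) - z (i - 1) - lam *\<^sub>R B (i - 1) (x (i - 1))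
          - lam *\<^sub>R (B (i - 2) (x (i - 1)) - B (i - 2) (x (i - 2))))"
    and x_n: "x n = resolvent lam (A n)
        (x 1 + x (n - 1) - z (n - 1)
          - lam *\<^sub>R (B (n - 2) (x (n - 1)) - B (n - 2) (x (n - 2))))"
  shows "splitting (z(0 := x 1, n := x 1)) (x(0 := x 1))" (is "splitting ?z ?x")
  unfolding splitting_iff_resolvent
proof (intro conjI allI impI)
  fix i assume "i < n"
  \<comment> \<open>The index \<open>i\<close> belongs to the component \<open>Suc i\<close>, so the
    four cases are the four lines of the algorithm; the third is empty for
    \<open>n = 3\<close>.\<close>
  then consider "i = 0" | "i = 1" | "2 \<le> i" "i \<le> n - 2" | "i = n - 1" "2 \<le> i" using n by linarith
  then show "?x (Suc i) = resolvent lam (A (Suc i))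
      (?z (Suc i) + ?x i - ?z i - lam *\<^sub>R B0 i (?x i) - lam *\<^sub>R jump ?x (i - 1))"
  proof cases
    case 1
    then show ?thesis using x_1 n by simp
  next
    case 2
    moreover have "Suc 0 \<le> n - 2" using n by simp
    ultimately show ?thesis using x_2 n by (simp add: B0_def numeral_2_eq_2)
  next
    case 3
    then have "Suc (i - 1) = i" "Suc i - 2 = i - 1" "Suc 0 \<le> i - Suc 0" "i - Suc 0 \<le> n - 2"
      "Suc i \<noteq> n" "i \<noteq> n" "Suc i \<le> n - 1"
      using n by auto
    with 3 show ?thesis using x_i[of "Suc i"] n by (simp add: B0_def jump_def)
  next
    case 4
    have n_eq: "n = Suc i" using 4 n by simp
    have "B0 i = (\<lambda>_. 0)" "B0 (i - 1) = B (i - 1)" "Suc (i - 1) = i"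
      using 4 n by (auto simp: B0_def fun_eq_iff)
    moreover from this have "jump ?x (i - 1) = B (i - 1) (x i) - B (i - 1) (x (i - 1))"
      unfolding jump_def using \<open>2 \<le> i\<close> by simp
    ultimately show ?thesis using x_n 4(2) by (simp add: n_eq numeral_2_eq_2)
  qed
qed (use n in auto)

text \<open>The recursive function satisfies the equations of the algorithm, hence uniqueness
  identifies it with any splitting over the same z-components.\<close>

lemma splitting_x_of:
  assumes q: "splitting q x" and z: "\<And>i. i \<in> {1..<n} \<Longrightarrow> z i = q i" and i: "i \<in> {1..n}"
  shows "x_of n lam A B z i = x i"
proof -
  define y where "y = x_of n lam A B z"
  have "splitting (z(0 := y 1, n := y 1)) (y(0 := y 1))"
  proof (rule splittingI)
    note y_eq = x_of.simps[of n lam A B z, folded y_def]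
    show "y 1 = resolvent lam (A 1) (z 1)" by (subst y_eq) simp
    show "y 2 = resolvent lam (A 2) (z 2 + y 1 - z 1 - lam *\<^sub>R B 1 (y 1))" by (subst y_eq) simp
    show "y i = resolvent lam (A i)
        (z i + y (i - 1) - z (i - 1) - lam *\<^sub>R B (i - 1) (y (i - 1))
          - lam *\<^sub>R (B (i - 2) (y (i - 1)) - B (i - 2) (y (i - 2))))" if "i \<in> {3..n-1}" for i
      using that by (subst y_eq) simp
    show "y n = resolvent lam (A n)
        (y 1 + y (n - 1) - z (n - 1)
          - lam *\<^sub>R (B (n - 2) (y (n - 1)) - B (n - 2) (y (n - 2))))"
      using n by (subst y_eq) auto
  qed
  then have "(y(0 := y 1)) i = x i"
    by (rule splitting_unique[OF _ _ q, rotated]) (use z i in auto)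
  then show ?thesis using i by (simp add: y_def)
qed

section \<open>Zeros as splittings with constant x\<close>

lemma sum_B0: "(\<Sum>i<n. B0 i p) = (\<Sum>i=1..n-2. B i p)"
proof -
  have "(\<Sum>i<n. B0 i p) = (\<Sum>i\<in>{1..n-2}. B0 i p)"
    by (rule sum.mono_neutral_right) (auto simp: B0_def)
  then show ?thesis by (simp add: B0_def)
qed

lemma mem_sum_op_iff:
  "u \<in> sum_op n A B p \<longleftrightarrow> (\<exists>a. (\<forall>i<n. a i \<in> A (Suc i) p) \<and> u = (\<Sum>i<n. a i + B0 i p))"
proof -
  have "(\<Sum>i=1..n-2. {B i p}) = {\<Sum>i=1..n-2. B i p}" by (induction "n - 2") (auto simp: set_sum_alt)
  moreover have "(\<Sum>i=1..n. A i p) = {\<Sum>i<n. a i | a. \<forall>i<n. a i \<in> A (Suc i) p}"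
  proof -
    have "(\<Sum>i=1..n. A i p) = (\<Sum>i<n. A (Suc i) p)"
      by (simp add: sum.atLeast1_atMost_eq)
    then show ?thesis by (simp add: set_sum_alt Ball_def)
  qed
  ultimately show ?thesis
    unfolding sum_op_def set_plus_def sum.distrib sum_B0 by auto
qed

lemma zer_iff_splitting: "p \<in> zer (sum_op n A B) \<longleftrightarrow> (\<exists>q. splitting q (\<lambda>_. p))"
proof
  assume "p \<in> zer (sum_op n A B)"
  then obtain a where a: "\<And>i. i < n \<Longrightarrow> a i \<in> A (Suc i) p" "(\<Sum>i<n. a i + B0 i p) = 0"
    unfolding zer_def mem_Collect_eq mem_sum_op_iff by metis
  \<comment> \<open>Partial sums make the increments of \<open>q\<close> equal to \<open>lam\<close>
    times the chosen values; the closing condition \<open>q n = p\<close> is the vanishing of the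
    full sum.\<close>
  define q where "q i = p + lam *\<^sub>R (\<Sum>j<i. a j + B0 j p)" for i
  have "dual_point q (\<lambda>_. p) i = a i + B0 i p" for i
    using lam(1) by (simp add: dual_point_def q_def scaleR_add_right)
  then have "splitting q (\<lambda>_. p)" using a by (simp add: splitting_def) (simp add: q_def)
  then show "\<exists>q. splitting q (\<lambda>_. p)" by blast
next
  assume "\<exists>q. splitting q (\<lambda>_. p)"
  then obtain q where q: "splitting q (\<lambda>_. p)" ..
  define a where "a i = dual_point q (\<lambda>_. p) i - B0 i p" for i
  have "(\<Sum>i<n. a i + B0 i p) = (1 / lam) *\<^sub>R (\<Sum>i<n. q (Suc i) - q i)"
    by (simp add: a_def dual_point_def scaleR_sum_right)
  also have "(\<Sum>i<n. q (Suc i) - q i) = 0"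
    using q by (simp add: sum_lessThan_telescope splitting_def)
  finally show "p \<in> zer (sum_op n A B)"
    unfolding zer_def mem_Collect_eq mem_sum_op_iff using q
    by (intro exI[of _ a]) (auto simp: a_def splitting_def)
qed

section \<open>Fejer monotonicity\<close>

lemma splitting_Fejer:
  assumes x: "splitting z x" and p: "splitting q (\<lambda>_. p)"
  shows "(\<Sum>i<n. inner (x (Suc i) - x i) (z i - q i))
    \<le> - (1 / 2 - lam * L) * (\<Sum>i<n. (norm (x (Suc i) - x i))\<^sup>2)"
proof -
  define e w F where "e i = x i - p" and "w i = z i - q i" and "F i = lam *\<^sub>R jump x i" for i
  have e: "e (Suc i) - e i = x (Suc i) - x i" for i by (simp add: e_def)
  have bd: "w 0 = e 0" "w n = e 0" using x p by (auto simp: splitting_def w_def e_def)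
  have F: "F 0 = 0" "F (n - 1) = 0" by (simp_all add: F_def)
  have "0 \<le> lam * (\<Sum>i<n. inner (e (Suc i)) (dual_point z x i - dual_point q (\<lambda>_. p) i))"
    using x p lam(1) unfolding splitting_def e_def
    by (intro mult_nonneg_nonneg sum_nonneg monotone_sum) auto
  also have "\<dots> = (\<Sum>i<n. inner (e (Suc i)) (w (Suc i) - w i - (e (Suc i) - e i) + F i - F (i - 1)))"
    unfolding sum_distrib_left
  proof (intro sum.cong refl)
    fix i
    have "w (Suc i) - w i - (e (Suc i) - e i) + F i - F (i - 1)
      = lam *\<^sub>R (dual_point z x i - dual_point q (\<lambda>_. p) i)"
      using lam(1) by (simp add: dual_point_def w_def e F_def algebra_simps)
    then show "lam * inner (e (Suc i)) (dual_point z x i - dual_point q (\<lambda>_. p) i)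
      = inner (e (Suc i)) (w (Suc i) - w i - (e (Suc i) - e i) + F i - F (i - 1))" by simp
  qed
  also have "\<dots> = inner (e n) (e 0) - (norm (e 0))\<^sup>2 / 2 - (norm (e n))\<^sup>2 / 2
      - (\<Sum>i<n. inner (e (Suc i) - e i) (w i)) - (\<Sum>i<n. (norm (e (Suc i) - e i))\<^sup>2) / 2
      + (\<Sum>i<n. - inner (e (Suc i) - e i) (F (i - 1)))"
    unfolding sum_inner_by_parts[where F = F, OF F(1)] bd F(2) by (simp add: sum_negf power2_norm_eq_inner)
  \<comment> \<open>Since \<open>w 0 = w n = e 0\<close> and \<open>F (n - 1) = 0\<close>, the
    boundary terms form a negative square, which is discarded at the end.\<close>
  also have "inner (e n) (e 0) - (norm (e 0))\<^sup>2 / 2 - (norm (e n))\<^sup>2 / 2 = - (norm (e n - e 0))\<^sup>2 / 2"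
    unfolding power2_norm_eq_inner by (simp add: inner_simps inner_commute field_simps)
  also have "(\<Sum>i<n. - inner (e (Suc i) - e i) (F (i - 1)))
      \<le> (\<Sum>i<n. lam * L / 2 * (norm (e (Suc i) - e i))\<^sup>2
          + lam * L / 2 * (norm (e (Suc (i - 1)) - e (i - 1)))\<^sup>2)"
  proof (rule sum_mono)
    fix i
    let ?a = "norm (e (Suc i) - e i)" and ?b = "norm (e (Suc (i - 1)) - e (i - 1))"
    have "- inner (e (Suc i) - e i) (F (i - 1)) \<le> ?a * norm (F (i - 1))"
      using Cauchy_Schwarz_ineq2[of "e (Suc i) - e i" "F (i - 1)"] by linarith
    also have "\<dots> \<le> ?a * (lam * (L * ?b))"
      using norm_jump_le[of x "i - 1"] lam(1) unfolding e
      by (intro mult_left_mono) (auto simp: F_def)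
    also have "\<dots> = lam * L * (?a * ?b)" by simp
    also have "\<dots> \<le> lam * L * (?a\<^sup>2 / 2 + ?b\<^sup>2 / 2)"
      using lam(1) L sum_squares_bound[of ?a ?b] by (intro mult_left_mono) auto
    finally show "- inner (e (Suc i) - e i) (F (i - 1)) \<le> lam * L / 2 * ?a\<^sup>2 + lam * L / 2 * ?b\<^sup>2"
      by (simp add: algebra_simps)
  qed
  \<comment> \<open>Young's inequality charged \<open>lam * L / 2\<close> to the increments at
    \<open>i\<close> and at \<open>i - 1\<close>. The second family is the first shifted by one, its
    entry at \<open>i = 0\<close> being zero because \<open>x 0 = x 1\<close>.\<close>
  also have "\<dots> \<le> lam * L * (\<Sum>i<n. (norm (e (Suc i) - e i))\<^sup>2)"
  proof -
    obtain m where m: "n = Suc m" using n by (cases n) auto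
    have "e (Suc 0) - e 0 = 0" using x by (simp add: e_def splitting_def)
    then have "(\<Sum>i<n. (norm (e (Suc (i - 1)) - e (i - 1)))\<^sup>2) = (\<Sum>i<m. (norm (e (Suc i) - e i))\<^sup>2)"
      unfolding m sum.lessThan_Suc_shift by simp
    also have "\<dots> \<le> (\<Sum>i<n. (norm (e (Suc i) - e i))\<^sup>2)" by (simp add: m)
    finally have "lam * L / 2 * (\<Sum>i<n. (norm (e (Suc (i - 1)) - e (i - 1)))\<^sup>2)
        \<le> lam * L / 2 * (\<Sum>i<n. (norm (e (Suc i) - e i))\<^sup>2)"
      using lam(1) L by (intro mult_left_mono) auto
    moreover have "a / 2 * s \<le> a / 2 * r \<Longrightarrow> a / 2 * r + a / 2 * s \<le> a * r" for a r s :: real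
      by (simp add: field_simps)
    ultimately show ?thesis unfolding sum.distrib sum_distrib_left[symmetric] by blast
  qed
  finally have "(\<Sum>i<n. inner (e (Suc i) - e i) (w i))
      \<le> lam * L * (\<Sum>i<n. (norm (e (Suc i) - e i))\<^sup>2) - (\<Sum>i<n. (norm (e (Suc i) - e i))\<^sup>2) / 2
        - (norm (e n - e 0))\<^sup>2 / 2"
    by linarith
  moreover have "- (1 / 2 - lam * L) * s = lam * L * s - s / 2" for s
    by (simp add: algebra_simps)
  moreover have "0 \<le> (norm (e n - e 0))\<^sup>2 / 2" by simp
  ultimately show ?thesis unfolding e w_def by (smt (verit))
qed

lemma splitting_zero_diff: "splitting z x \<Longrightarrow> x 1 - x 0 = 0"
  by (simp add: splitting_def)

text \<open>The inclusion for \<open>i = 0\<close> says that \<open>x 1\<close> is the resolvent of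
  \<open>z 1\<close>. It serves to bound the first components of the iterates.\<close>

lemma splitting_x_1_nonexpansive:
  assumes "splitting z x" "splitting z' x'"
  shows "norm (x 1 - x' 1) \<le> norm (z 1 - z' 1)"
proof -
  have *: "dual_point z x 0 = (1 / lam) *\<^sub>R (z 1 - x 1)" if "splitting z x" for z x
    using that by (simp add: dual_point_def splitting_def)
  have mem: "dual_point z x 0 \<in> A (Suc 0) (x 1)" if "splitting z x" for z x
    using that n unfolding splitting_def by (auto dest: spec[of _ 0])
  have "0 \<le> inner (x 1 - x' 1) (dual_point z x 0 - dual_point z' x' 0)"
    using n by (intro monotone_A[of 0] mem assms) simp
  also have "dual_point z x 0 - dual_point z' x' 0 = (1 / lam) *\<^sub>R ((z 1 - z' 1) - (x 1 - x' 1))"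
    using assms by (simp add: * algebra_simps)
  finally have "0 \<le> inner (x 1 - x' 1) (z 1 - z' 1) - (norm (x 1 - x' 1))\<^sup>2"
    using lam(1) by (simp add: zero_le_mult_iff zero_le_divide_iff inner_diff_right power2_norm_eq_inner)
  also have "\<dots> \<le> norm (x 1 - x' 1) * norm (z 1 - z' 1) - norm (x 1 - x' 1) * norm (x 1 - x' 1)"
    using norm_cauchy_schwarz[of "x 1 - x' 1" "z 1 - z' 1"] by (simp add: power2_eq_square)
  finally have "norm (x 1 - x' 1) * norm (x 1 - x' 1) \<le> norm (x 1 - x' 1) * norm (z 1 - z' 1)" by simp
  then show ?thesis by (cases "x 1 = x' 1") auto
qed

section \<open>Demiclosedness: weak limits of splittings\<close>

lemma splitting_demiclosed:
  fixes z x :: "'k \<Rightarrow> nat \<Rightarrow> 'a"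
  assumes G: "G \<noteq> bot" and zx: "\<And>k. splitting (z k) (x k)"
    and x_bounded: "\<And>k. norm (x k 1) \<le> M"
    and z_bounded: "\<And>i k. i \<in> {1..<n} \<Longrightarrow> norm (z k i) \<le> M"
    and residual: "\<And>i. i < n \<Longrightarrow> ((\<lambda>k. x k (Suc i) - x k i) \<longlongrightarrow> 0) G"
    and z: "\<And>i. i \<in> {1..<n} \<Longrightarrow> weakly_tendsto (\<lambda>k. z k i) (q i) G"
    and x: "weakly_tendsto (\<lambda>k. x k 1) p G"
    and q: "q 0 = p" "q n = p"
  shows "splitting q (\<lambda>_. p)"
proof -
  have bd: "z k 0 = x k 1" "z k n = x k 1" "x k 0 = x k 1" for k
    using zx[of k] by (auto simp: splitting_def)
  have z_weak: "weakly_tendsto (\<lambda>k. z k i) (q i) G" if "i \<le> n" for i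
    using that z[of i] x by (cases "i = 0 \<or> i = n") (auto simp: bd q)
  have z_norm: "norm (z k i) \<le> M" if "i \<le> n" for i k
    using that z_bounded[of i k] x_bounded[of k] by (cases "i = 0 \<or> i = n") (auto simp: bd)
  define dz where "dz k i = (1 / lam) *\<^sub>R (z k (Suc i) - z k i)" for k i
  define c where "c i = (1 / lam) *\<^sub>R (q (Suc i) - q i)" for i
  \<comment> \<open>The dual points split into a weakly convergent part \<open>dz\<close>, whose sum
    over the ring telescopes to 0, and a strongly null remainder \<open>r\<close>.\<close>
  define r where "r k i = dual_point (z k) (x k) i - dz k i" for k i
  have dual: "dual_point (z k) (x k) i = dz k i + r k i" for k i by (simp add: r_def)
  have dz_weak: "weakly_tendsto (\<lambda>k. dz k i) (c i) G" if "i < n" for i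
    unfolding dz_def c_def using that by (intro weakly_tendsto_scaleR weakly_tendsto_diff z_weak) auto
  have dz_norm: "norm (dz k i) \<le> (1 / lam) * (M + M)" if "i < n" for k i
  proof -
    have "norm (z k (Suc i) - z k i) \<le> M + M"
      using norm_triangle_ineq4[of "z k (Suc i)" "z k i"] z_norm[of "Suc i" k] z_norm[of i k] that by simp
    then show ?thesis unfolding dz_def using lam(1) by (simp add: divide_right_mono)
  qed
  have sum_c: "(\<Sum>i<n. c i) = 0"
    using q unfolding c_def by (simp add: sum_lessThan_telescope flip: scaleR_sum_right)
  have sum_dz: "(\<Sum>i<n. dz k i) = 0" for k
    unfolding dz_def by (simp add: sum_lessThan_telescope bd flip: scaleR_sum_right)
  have jump: "((\<lambda>k. jump (x k) i) \<longlongrightarrow> 0) G" if "i < n" for i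
  proof (rule Lim_null_comparison)
    show "\<forall>\<^sub>F k in G. norm (jump (x k) i) \<le> L * norm (x k (Suc i) - x k i)"
      by (simp add: norm_jump_le)
    show "((\<lambda>k. L * norm (x k (Suc i) - x k i)) \<longlongrightarrow> 0) G"
      using tendsto_mult_left[OF tendsto_norm_zero[OF residual[OF that]], of L] by simp
  qed
  have r: "((\<lambda>k. r k i) \<longlongrightarrow> 0) G" if "i < n" for i
  proof -
    have "((\<lambda>k. (- (1 / lam)) *\<^sub>R (x k (Suc i) - x k i) + jump (x k) i - jump (x k) (i - 1))
        \<longlongrightarrow> (- (1 / lam)) *\<^sub>R 0 + 0 - 0) G"
      using that by (intro tendsto_intros residual jump) auto
    moreover have "r k i = (- (1 / lam)) *\<^sub>R (x k (Suc i) - x k i) + jump (x k) i - jump (x k) (i - 1)" for k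
      by (simp add: r_def dz_def dual_point_def algebra_simps)
    ultimately show ?thesis by simp
  qed
  define d where "d k i = x k (Suc i) - x k 1" for k i
  have d: "((\<lambda>k. d k i) \<longlongrightarrow> 0) G" if "i < n" for i
    using that
  proof (induction i)
    case (Suc i)
    then have "((\<lambda>k. d k i + (x k (Suc (Suc i)) - x k (Suc i))) \<longlongrightarrow> 0 + 0) G"
      by (intro tendsto_add residual) auto
    then show ?case by (simp add: d_def)
  qed (simp add: d_def)
  have x_Suc: "x k (Suc i) = x k 1 + d k i" for k i by (simp add: d_def)
  have x_weak: "weakly_tendsto (\<lambda>k. x k (Suc i)) p G" if "i < n" for i
    using weakly_tendsto_add[OF x tendsto_imp_weakly_tendsto[OF d[OF that]]] by (simp only: x_Suc add_0_right)
  have dual_weak: "weakly_tendsto (\<lambda>k. dual_point (z k) (x k) i) (c i) G" if "i < n" for i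
    using weakly_tendsto_add[OF dz_weak tendsto_imp_weakly_tendsto[OF r], OF that that] by (simp only: dual add_0_right)
  \<comment> \<open>With \<open>x k (Suc i) = x k 1 + d k i\<close>, the only product without a
    strongly null factor is \<open>x k 1\<close> against the sum of the \<open>dz k i\<close>, and
    that sum is zero.\<close>
  have pairing: "((\<lambda>k. \<Sum>i<n. inner (x k (Suc i)) (dual_point (z k) (x k) i)) \<longlongrightarrow> 0) G"
  proof -
    have "((\<lambda>k. inner (x k 1) (\<Sum>i<n. r k i) + (\<Sum>i<n. inner (dz k i) (d k i)) + (\<Sum>i<n. inner (d k i) (r k i)))
      \<longlongrightarrow> 0 + (\<Sum>i<n. 0) + (\<Sum>i<n. 0)) G"
    proof (intro tendsto_add tendsto_sum)
      have "((\<lambda>k. \<Sum>i<n. r k i) \<longlongrightarrow> (\<Sum>i<n. 0)) G" by (intro tendsto_sum r) auto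
      then show "((\<lambda>k. inner (x k 1) (\<Sum>i<n. r k i)) \<longlongrightarrow> 0) G"
        using x_bounded by (intro tendsto_inner_bounded_null[where M = M]) auto
      show "((\<lambda>k. inner (dz k i) (d k i)) \<longlongrightarrow> 0) G" if "i \<in> {..<n}" for i
        using that dz_norm d by (intro tendsto_inner_bounded_null[where M = "(1 / lam) * (M + M)"]) auto
      show "((\<lambda>k. inner (d k i) (r k i)) \<longlongrightarrow> 0) G" if "i \<in> {..<n}" for i
        using that tendsto_inner[OF d r, of i i] by simp
    qed
    moreover have "(\<Sum>i<n. inner (x k (Suc i)) (dual_point (z k) (x k) i))
        = inner (x k 1) (\<Sum>i<n. r k i) + (\<Sum>i<n. inner (dz k i) (d k i)) + (\<Sum>i<n. inner (d k i) (r k i))"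
      for k
    proof -
      have "(\<Sum>i<n. inner (x k (Suc i)) (dual_point (z k) (x k) i))
        = inner (x k 1) (\<Sum>i<n. dz k i) + inner (x k 1) (\<Sum>i<n. r k i)
          + (\<Sum>i<n. inner (dz k i) (d k i)) + (\<Sum>i<n. inner (d k i) (r k i))"
        unfolding inner_sum_right x_Suc dual by (simp add: inner_simps inner_commute sum.distrib)
      then show ?thesis by (simp add: sum_dz)
    qed
    ultimately show ?thesis by simp
  qed
  \<comment> \<open>Test against the points \<open>(y\<^sub>i, w\<^sub>i)\<close> of the graphs with \<open>y\<^sub>i + lam w\<^sub>i = p + lam c\<^sub>i\<close>: the limiting
    inequality becomes \<open>\<Sum> \<parallel>p - y\<^sub>i\<parallel>\<^sup>2 \<le> 0\<close>.\<close>
  have "\<exists>y. (1 / lam) *\<^sub>R ((p + lam *\<^sub>R c i) - y) - B0 i y \<in> A (Suc i) y" if "i < n" for i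
  proof (rule resolvent_surj_Lipschitz_sum)
    show "maximally_monotone (A (Suc i))" using A that by simp
    show "L-lipschitz_on UNIV (B0 i)" using L by (intro lipschitz_onI) (simp_all add: dist_norm B0_lip)
    show "lam * L < 1" using lam mult_pos_pos[OF lam(1) L] by linarith
  qed (rule lam)
  then obtain y where y: "\<And>i. i < n \<Longrightarrow> (1 / lam) *\<^sub>R ((p + lam *\<^sub>R c i) - y i) - B0 i (y i) \<in> A (Suc i) (y i)"
    by metis
  define w where "w i = (1 / lam) *\<^sub>R ((p + lam *\<^sub>R c i) - y i)" for i
  have w: "w i = c i + (1 / lam) *\<^sub>R (p - y i)" for i
    using lam(1) by (simp add: w_def algebra_simps)
  have nonneg: "0 \<le> (\<Sum>i<n. inner (x k (Suc i) - y i) (dual_point (z k) (x k) i - w i))" for k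
    using zx[of k] y unfolding splitting_def w_def
    by (intro sum_nonneg monotone_sum) auto
  have "((\<lambda>k. (\<Sum>i<n. inner (x k (Suc i)) (dual_point (z k) (x k) i))
        - (\<Sum>i<n. inner (x k (Suc i)) (w i)) - (\<Sum>i<n. inner (dual_point (z k) (x k) i) (y i))
        + (\<Sum>i<n. inner (y i) (w i)))
      \<longlongrightarrow> 0 - (\<Sum>i<n. inner p (w i)) - (\<Sum>i<n. inner (c i) (y i)) + (\<Sum>i<n. inner (y i) (w i))) G"
    by (intro tendsto_intros pairing weakly_tendstoD x_weak dual_weak) auto
  moreover have "(\<Sum>i<n. inner (x k (Suc i) - y i) (dual_point (z k) (x k) i - w i))
      = (\<Sum>i<n. inner (x k (Suc i)) (dual_point (z k) (x k) i))
        - (\<Sum>i<n. inner (x k (Suc i)) (w i)) - (\<Sum>i<n. inner (dual_point (z k) (x k) i) (y i))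
        + (\<Sum>i<n. inner (y i) (w i))" for k
    by (simp add: inner_diff_left inner_diff_right sum_subtractf inner_commute)
  ultimately have "0 \<le> 0 - (\<Sum>i<n. inner p (w i)) - (\<Sum>i<n. inner (c i) (y i)) + (\<Sum>i<n. inner (y i) (w i))"
    using nonneg by (intro tendsto_lowerbound[OF _ _ G]) auto
  \<comment> \<open>The choice of test points enters as
    \<open>w i - c i = (1 / lam) *\<^sub>R (p - y i)\<close>, while the term with \<open>p\<close>
    drops out because the \<open>c i\<close> sum to 0.\<close>
  also have "\<dots> = - inner p (\<Sum>i<n. c i) - (\<Sum>i<n. inner (p - y i) (w i - c i))"
    by (simp add: inner_sum_right inner_diff_left inner_diff_right sum_subtractf inner_commute)
  also have "\<dots> = - (1 / lam) * (\<Sum>i<n. (norm (p - y i))\<^sup>2)"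
    by (simp add: sum_c w power2_norm_eq_inner sum_distrib_left sum_negf sum_divide_distrib)
  finally have "(\<Sum>i<n. (norm (p - y i))\<^sup>2) \<le> 0"
    using lam(1) by (simp add: divide_le_0_iff)
  then have "(\<Sum>i<n. (norm (p - y i))\<^sup>2) = 0" by (intro order_antisym sum_nonneg) auto
  then have "y i = p" if "i < n" for i
    using that by (subst (asm) sum_nonneg_eq_0_iff) auto
  then have "c i - B0 i p \<in> A (Suc i) p" if "i < n" for i
    using y[OF that] that lam(1) by simp
  moreover have "dual_point q (\<lambda>_. p) i = c i" for i by (simp add: dual_point_def c_def)
  ultimately show ?thesis using q by (simp add: splitting_def)
qed

section \<open>Weak convergence of the iteration\<close>

lemma splitting_Fejer_step:
  assumes \<gamma>: "0 < \<gamma>" and x: "splitting z x" and q: "splitting q (\<lambda>_. p)"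
    and step: "\<And>i. i \<in> {1..<n} \<Longrightarrow> z' i = z i + \<gamma> *\<^sub>R (x (Suc i) - x i)"
  shows "(\<Sum>i=1..<n. (norm (z' i - q i))\<^sup>2)
    \<le> (\<Sum>i=1..<n. (norm (z i - q i))\<^sup>2) - \<gamma> * (1 - 2 * lam * L - \<gamma>) * (\<Sum>i<n. (norm (x (Suc i) - x i))\<^sup>2)"
proof -
  let ?d = "\<lambda>i. x (Suc i) - x i"
  have "?d 0 = 0" using splitting_zero_diff[OF x] by simp
  \<comment> \<open>The Lyapunov sum starts at 1 but the Fejer estimate at 0; the extra term
    vanishes with the increment at 0.\<close>
  then have shift: "(\<Sum>i=1..<n. f (?d i) i) = (\<Sum>i<n. f (?d i) i)" if "\<And>i. f 0 i = 0" for f :: "'a \<Rightarrow> nat \<Rightarrow> real"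
    using that n by (intro sum.mono_neutral_left) (auto simp: not_less_eq_eq dest!: le_antisym[of _ 0])
  have "(\<Sum>i=1..<n. (norm (z' i - q i))\<^sup>2)
      = (\<Sum>i=1..<n. (norm (z i - q i))\<^sup>2 + 2 * \<gamma> * inner (?d i) (z i - q i) + \<gamma>\<^sup>2 * (norm (?d i))\<^sup>2)"
    unfolding power2_norm_eq_inner
    by (intro sum.cong refl) (simp add: step inner_simps inner_commute algebra_simps power2_eq_square)
  also have "\<dots> = (\<Sum>i=1..<n. (norm (z i - q i))\<^sup>2) + 2 * \<gamma> * (\<Sum>i<n. inner (?d i) (z i - q i))
      + \<gamma>\<^sup>2 * (\<Sum>i<n. (norm (?d i))\<^sup>2)"
    using shift[of "\<lambda>d i. inner d (z i - q i)"] shift[of "\<lambda>d i. (norm d)\<^sup>2"]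
    by (simp add: sum.distrib flip: sum_distrib_left)
  also have "\<dots> \<le> (\<Sum>i=1..<n. (norm (z i - q i))\<^sup>2)
      + 2 * \<gamma> * (- (1 / 2 - lam * L) * (\<Sum>i<n. (norm (?d i))\<^sup>2)) + \<gamma>\<^sup>2 * (\<Sum>i<n. (norm (?d i))\<^sup>2)"
    using splitting_Fejer[OF x q] \<gamma> by (intro add_mono mult_left_mono) auto
  also have "\<dots> = (\<Sum>i=1..<n. (norm (z i - q i))\<^sup>2)
      - \<gamma> * (1 - 2 * lam * L - \<gamma>) * (\<Sum>i<n. (norm (?d i))\<^sup>2)"
    by (simp add: algebra_simps power2_eq_square)
  finally show ?thesis .
qed

text \<open>Opial's argument: the difference of the two squared distances is affine in
  \<open>z k\<close>, hence passes to weak limits. Along \<open>G\<close> it tends to minus the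
  squared distance of \<open>q\<close> and \<open>q'\<close>, along \<open>G'\<close> to plus that
  distance, and both limits equal \<open>l\<close>.\<close>

lemma splitting_limit_unique:
  fixes z :: "nat \<Rightarrow> nat \<Rightarrow> 'a"
  assumes conv: "convergent (\<lambda>k. \<Sum>i=1..<n. (norm (z k i - q i))\<^sup>2)"
      "convergent (\<lambda>k. \<Sum>i=1..<n. (norm (z k i - q' i))\<^sup>2)"
    and G: "G \<le> sequentially" "G \<noteq> bot" "\<And>i. i \<in> {1..<n} \<Longrightarrow> weakly_tendsto (\<lambda>k. z k i) (q i) G"
    and G': "G' \<le> sequentially" "G' \<noteq> bot" "\<And>i. i \<in> {1..<n} \<Longrightarrow> weakly_tendsto (\<lambda>k. z k i) (q' i) G'"
    and i: "i \<in> {1..<n}"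
  shows "q i = q' i"
proof -
  let ?V = "\<lambda>k. (\<Sum>i=1..<n. (norm (z k i - q i))\<^sup>2) - (\<Sum>i=1..<n. (norm (z k i - q' i))\<^sup>2)"
  let ?W = "\<lambda>k. \<Sum>i=1..<n. inner (q i) (q i) - inner (q' i) (q' i) - 2 * inner (z k i) (q i - q' i)"
  obtain l where l: "?V \<longlonglongrightarrow> l" using convergent_diff[OF conv] by (auto simp: convergent_def)
  have V: "?V k = ?W k" for k
    unfolding sum_subtractf[symmetric] power2_norm_eq_inner
    by (intro sum.cong refl) (simp add: inner_simps inner_commute algebra_simps)
  have lim: "l = (\<Sum>i=1..<n. inner (q i) (q i) - inner (q' i) (q' i) - 2 * inner (c i) (q i - q' i))"
    if "G \<le> sequentially" "G \<noteq> bot" "\<And>i. i \<in> {1..<n} \<Longrightarrow> weakly_tendsto (\<lambda>k. z k i) (c i) G" for G c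
  proof (rule tendsto_unique)
    show "(?W \<longlongrightarrow> l) G" using tendsto_mono[OF that(1) l] by (simp only: V)
    show "(?W \<longlongrightarrow> (\<Sum>i=1..<n. inner (q i) (q i) - inner (q' i) (q' i) - 2 * inner (c i) (q i - q' i))) G"
      by (intro tendsto_intros weakly_tendstoD that)
  qed fact
  let ?S = "\<Sum>i=1..<n. (norm (q i - q' i))\<^sup>2"
  have "l = (\<Sum>i=1..<n. inner (q i) (q i) - inner (q' i) (q' i) - 2 * inner (q i) (q i - q' i))"
    by (rule lim[OF G])
  also have "\<dots> = (\<Sum>i=1..<n. - (norm (q i - q' i))\<^sup>2)"
    unfolding power2_norm_eq_inner
    by (intro sum.cong refl) (simp add: inner_diff_left inner_diff_right inner_commute)
  finally have "l = - ?S" by (simp add: sum_negf)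
  moreover have "l = ?S"
  proof -
    have "l = (\<Sum>i=1..<n. inner (q i) (q i) - inner (q' i) (q' i) - 2 * inner (q' i) (q i - q' i))"
      by (rule lim[OF G'])
    also have "\<dots> = ?S"
      unfolding power2_norm_eq_inner
      by (intro sum.cong refl) (simp add: inner_diff_left inner_diff_right inner_commute)
    finally show ?thesis .
  qed
  ultimately have "?S = 0" by linarith
  then show ?thesis using i by (subst (asm) sum_nonneg_eq_0_iff) auto
qed

lemma splitting_iteration_converges:
  fixes z x :: "nat \<Rightarrow> nat \<Rightarrow> 'a"
  assumes zer: "zer (sum_op n A B) \<noteq> {}"
    and \<gamma>: "0 < \<gamma>" "\<gamma> < 1 - 2 * lam * L"
    and zx: "\<And>k. splitting (z k) (x k)"
    and step: "\<And>k i. i \<in> {1..<n} \<Longrightarrow> z (Suc k) i = z k i + \<gamma> *\<^sub>R (x k (Suc i) - x k i)"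
  obtains q p where "splitting q (\<lambda>_. p)"
    and "\<And>i. i \<in> {1..<n} \<Longrightarrow> weakly_tendsto (\<lambda>k. z k i) (q i) sequentially"
    and "\<And>i. i \<in> {1..n} \<Longrightarrow> weakly_tendsto (\<lambda>k. x k i) p sequentially"
proof -
  obtain q0 p0 where q0: "splitting q0 (\<lambda>_. p0)" using zer zer_iff_splitting by blast
  let ?V = "\<lambda>q k. \<Sum>i=1..<n. (norm (z k i - q i))\<^sup>2"
  let ?D = "\<lambda>k. \<Sum>i<n. (norm (x k (Suc i) - x k i))\<^sup>2"
  define \<kappa> where "\<kappa> = \<gamma> * (1 - 2 * lam * L - \<gamma>)"
  have "\<kappa> > 0" using \<gamma> by (simp add: \<kappa>_def)
  have V_step: "?V q (Suc k) \<le> ?V q k - \<kappa> * ?D k" if "splitting q (\<lambda>_. p)" for q p k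
    unfolding \<kappa>_def using splitting_Fejer_step[OF \<gamma>(1) zx that step] .
  have V_decseq: "decseq (?V q)" if "splitting q (\<lambda>_. p)" for q p
  proof (rule decseq_SucI)
    fix k
    have "0 \<le> \<kappa> * ?D k" using \<open>\<kappa> > 0\<close> by (intro mult_nonneg_nonneg sum_nonneg) auto
    then show "?V q (Suc k) \<le> ?V q k" using V_step[OF that, of k] by linarith
  qed
  have V_convergent: "convergent (?V q)" if "splitting q (\<lambda>_. p)" for q p
    by (rule decseq_convergent[OF V_decseq[OF that], of 0]) (simp add: sum_nonneg, rule convergentI)
  have D: "?D \<longlonglongrightarrow> 0"
  proof -
    obtain l where l: "?V q0 \<longlonglongrightarrow> l" using V_convergent[OF q0] by (auto simp: convergent_def)
    \<comment> \<open>The decrements of a convergent sequence tend to 0 and dominate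
      \<open>?D\<close>.\<close>
    have "(\<lambda>k. (?V q0 k - ?V q0 (Suc k)) / \<kappa>) \<longlonglongrightarrow> (l - l) / \<kappa>"
      using \<open>\<kappa> > 0\<close> by (intro tendsto_intros l LIMSEQ_Suc) auto
    moreover have "?D k \<le> (?V q0 k - ?V q0 (Suc k)) / \<kappa>" for k
      using V_step[OF q0, of k] \<open>\<kappa> > 0\<close> by (simp add: pos_le_divide_eq mult.commute)
    ultimately show ?thesis
      by (intro tendsto_sandwich[of "\<lambda>_. 0" ?D _ "\<lambda>k. (?V q0 k - ?V q0 (Suc k)) / \<kappa>"])
        (auto intro!: always_eventually sum_nonneg)
  qed
  have residual: "(\<lambda>k. x k (Suc i) - x k i) \<longlonglongrightarrow> 0" if "i < n" for i
  proof (rule Lim_null_comparison)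
    show "\<forall>\<^sub>F k in sequentially. norm (x k (Suc i) - x k i) \<le> sqrt (?D k)"
      using that by (intro always_eventually allI real_le_rsqrt member_le_sum) auto
    show "(\<lambda>k. sqrt (?D k)) \<longlonglongrightarrow> 0" using tendsto_real_sqrt[OF D] by simp
  qed
  have z_q0: "norm (z k i - q0 i) \<le> sqrt (?V q0 0)" if "i \<in> {1..<n}" for i k
  proof (rule real_le_rsqrt)
    have "(norm (z k i - q0 i))\<^sup>2 \<le> ?V q0 k" using that by (intro member_le_sum) auto
    also have "\<dots> \<le> ?V q0 0" using V_decseq[OF q0] by (simp add: decseq_def)
    finally show "(norm (z k i - q0 i))\<^sup>2 \<le> ?V q0 0" .
  qed
  define M where "M = sqrt (?V q0 0) + norm p0 + (\<Sum>i=1..<n. norm (q0 i))"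
  have z_bounded: "norm (z k i) \<le> M" if "i \<in> {1..<n}" for i k
  proof -
    have "norm (q0 i) \<le> (\<Sum>i=1..<n. norm (q0 i))" using that by (intro member_le_sum) auto
    then show ?thesis
      using norm_triangle_sub[of "z k i" "q0 i"] z_q0[OF that, of k] norm_ge_zero[of p0] unfolding M_def by linarith
  qed
  have x_bounded: "norm (x k 1) \<le> M" for k
  proof -
    have "norm (x k 1 - p0) \<le> sqrt (?V q0 0)"
      using splitting_x_1_nonexpansive[OF zx q0, of k] z_q0[of 1 k] n by simp
    moreover have "0 \<le> (\<Sum>i=1..<n. norm (q0 i))" by (simp add: sum_nonneg)
    ultimately show ?thesis using norm_triangle_sub[of "x k 1" p0] unfolding M_def by linarith
  qed
  have cluster: "\<exists>G' q p. G' \<le> G \<and> G' \<noteq> bot \<and> splitting q (\<lambda>_. p) \<and> weakly_tendsto (\<lambda>k. x k 1) p G' \<and>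
      (\<forall>i\<in>{1..<n}. weakly_tendsto (\<lambda>k. z k i) (q i) G')"
    if G: "G \<le> sequentially" "G \<noteq> bot" for G
  proof -
    \<comment> \<open>Slot 0 carries the first x-component, so that one extraction gives a common
      subfilter for it and all z-components. Copying \<open>c 0\<close> into position
      \<open>n\<close> then supplies the second boundary value of the limit.\<close>
    define f where "f i = (\<lambda>k. if i = 0 then x k 1 else z k i)" for i
    have "\<exists>M. \<forall>\<^sub>F k in G. norm (f i k) \<le> M" if "i \<in> {..<n}" for i
      using that x_bounded z_bounded[of i] by (intro exI[of _ M] always_eventually) (auto simp: f_def)
    then obtain G' c where G': "G' \<le> G" "G' \<noteq> bot" "\<And>i. i < n \<Longrightarrow> weakly_tendsto (f i) (c i) G'"
      using bounded_family_weak_cluster_point[of "{..<n}" G f] G(2) by auto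
    have z: "weakly_tendsto (\<lambda>k. z k i) ((c(n := c 0)) i) G'" if "i \<in> {1..<n}" for i
      using G'(3)[of i] that by (simp add: f_def)
    have x: "weakly_tendsto (\<lambda>k. x k 1) (c 0) G'" using G'(3)[of 0] n by (simp add: f_def)
    have "splitting (c(n := c 0)) (\<lambda>_. c 0)"
    proof (rule splitting_demiclosed[OF G'(2) zx x_bounded z_bounded _ z x])
      show "((\<lambda>k. x k (Suc i) - x k i) \<longlongrightarrow> 0) G'" if "i < n" for i
        using tendsto_mono[OF order_trans[OF G'(1) G(1)] residual[OF that]] .
    qed (use n in auto)
    then show ?thesis using G' z x by blast
  qed
  obtain G q p where G: "G \<le> sequentially" "G \<noteq> bot" and q: "splitting q (\<lambda>_. p)"
    and z_G: "\<And>i. i \<in> {1..<n} \<Longrightarrow> weakly_tendsto (\<lambda>k. z k i) (q i) G"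
    using cluster[of sequentially] by auto
  have subfilter: "\<exists>G''\<le>G'. G'' \<noteq> bot \<and> weakly_tendsto (\<lambda>k. x k 1) p G'' \<and>
      (\<forall>i\<in>{1..<n}. weakly_tendsto (\<lambda>k. z k i) (q i) G'')"
    if G': "G' \<le> sequentially" "G' \<noteq> bot" for G'
  proof -
    obtain G'' q' p' where G'': "G'' \<le> G'" "G'' \<noteq> bot" and q': "splitting q' (\<lambda>_. p')"
      and x'': "weakly_tendsto (\<lambda>k. x k 1) p' G''"
      and z'': "\<And>i. i \<in> {1..<n} \<Longrightarrow> weakly_tendsto (\<lambda>k. z k i) (q' i) G''"
      using cluster[OF G'] by blast
    have eq: "q i = q' i" if "i \<in> {1..<n}" for i
      using splitting_limit_unique[OF V_convergent[OF q] V_convergent[OF q'] G z_G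
          order_trans[OF G''(1) G'(1)] G''(2) z'' that] .
    \<comment> \<open>Opial identifies only the z-components; these determine the x-components of a
      splitting, hence the constant value.\<close>
    have "p = p'" using splitting_unique[OF eq q q', of 1] n by simp
    then show ?thesis using G'' x'' z'' eq by (intro exI[of _ G'']) auto
  qed
  have "weakly_tendsto (\<lambda>k. z k i) (q i) sequentially" if "i \<in> {1..<n}" for i
    unfolding weakly_tendsto_def
  proof (intro allI tendsto_if_subfilters)
    fix u G' assume "G' \<le> sequentially" "G' \<noteq> bot"
    then show "\<exists>G''\<le>G'. G'' \<noteq> bot \<and> ((\<lambda>k. inner (z k i) u) \<longlongrightarrow> inner (q i) u) G''"
      using subfilter that weakly_tendstoD by blast
  qed
  moreover have x_1: "weakly_tendsto (\<lambda>k. x k 1) p sequentially"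
    unfolding weakly_tendsto_def
  proof (intro allI tendsto_if_subfilters)
    fix u G' assume "G' \<le> sequentially" "G' \<noteq> bot"
    then show "\<exists>G''\<le>G'. G'' \<noteq> bot \<and> ((\<lambda>k. inner (x k 1) u) \<longlongrightarrow> inner p u) G''"
      using subfilter weakly_tendstoD by blast
  qed
  have "weakly_tendsto (\<lambda>k. x k (Suc i)) p sequentially" if "i < n" for i
    using that
  proof (induction i)
    case (Suc i)
    then show ?case
      using weakly_tendsto_add[OF _ tendsto_imp_weakly_tendsto[OF residual[of "Suc i"]]] by fastforce
  qed (use x_1 in simp)
  then have "weakly_tendsto (\<lambda>k. x k i) p sequentially" if "i \<in> {1..n}" for i
    using that by (cases i) auto
  ultimately show ?thesis using that q by blast
qed

text \<open>Constant x makes every increment in \<open>T_tilde\<close> zero. Restriction is required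
  because tuples are \<open>undefined\<close> off their index set.\<close>

lemma Fix_T_tilde_of_splitting:
  assumes q: "splitting q (\<lambda>_. p)"
  shows "restrict q {1..n-1} \<in> Fix_on (tuples (n - 1)) (T_tilde n lam \<gamma> A B)"
proof -
  have "x_of n lam A B (restrict q {1..n-1}) i = p" if "i \<in> {1..n}" for i
    by (rule splitting_x_of[OF q _ that]) auto
  then have "T_tilde n lam \<gamma> A B (restrict q {1..n-1}) = restrict q {1..n-1}"
    unfolding T_tilde_def by (intro restrict_ext) auto
  then show ?thesis by (simp add: Fix_on_def tuples_def)
qed

end

lemma tuple_weakly_convergesI:
  assumes "\<And>i. i \<in> {1..m} \<Longrightarrow> weakly_tendsto (\<lambda>k. v k i) (w i) sequentially"
  shows "tuple_weakly_converges m v w"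
  unfolding tuple_weakly_converges_def tuple_inner_def
  by (intro ballI tendsto_sum weakly_tendstoD assms)

theorem theorem4p4:
  fixes n :: nat
    and L lam \<gamma> :: real
    and A :: "nat \<Rightarrow> 'a::{real_inner, complete_space} \<Rightarrow> 'a set"
    and B :: "nat \<Rightarrow> 'a \<Rightarrow> 'a"
    and z x :: "nat \<Rightarrow> nat \<Rightarrow> 'a"
  assumes n: "n \<ge> 3"
    and L: "L > 0"
    and A: "\<And>i. i \<in> {1..n} \<Longrightarrow> maximally_monotone (A i)"
    and B_mono: "\<And>i. i \<in> {1..n-2} \<Longrightarrow> monotone_op (\<lambda>y. {B i y})"
    and B_lip: "\<And>i. i \<in> {1..n-2} \<Longrightarrow> L-lipschitz_on UNIV (B i)"
    and zer: "zer (sum_op n A B) \<noteq> {}"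
    and lam: "lam \<in> {0<..<1 / (2 * L)}"
    and \<gamma>: "\<gamma> \<in> {0<..<1 - 2 * lam * L}"
    and z_tuple: "\<And>k. z k \<in> tuples (n - 1)"
    and x_tuple: "\<And>k. x k \<in> tuples n"
    and x_1: "\<And>k. x k 1 = resolvent lam (A 1) (z k 1)"
    and x_2: "\<And>k. x k 2 = resolvent lam (A 2) (z k 2 + x k 1 - z k 1 - lam *\<^sub>R B 1 (x k 1))"
    and x_i: "\<And>k i. i \<in> {3..n-1} \<Longrightarrow> x k i = resolvent lam (A i)
        (z k i + x k (i - 1) - z k (i - 1) - lam *\<^sub>R B (i - 1) (x k (i - 1))
          - lam *\<^sub>R (B (i - 2) (x k (i - 1)) - B (i - 2) (x k (i - 2))))"
    and x_n: "\<And>k. x k n = resolvent lam (A n)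
        (x k 1 + x k (n - 1) - z k (n - 1)
          - lam *\<^sub>R (B (n - 2) (x k (n - 1)) - B (n - 2) (x k (n - 2))))"
    and z_Suc: "\<And>k i. i \<in> {1..n-1} \<Longrightarrow> z (Suc k) i = z k i + \<gamma> *\<^sub>R (x k (i + 1) - x k i)"
  shows "(\<exists>z'\<in>Fix_on (tuples (n - 1)) (T_tilde n lam \<gamma> A B). tuple_weakly_converges (n - 1) z z')
    \<and> (\<exists>x'\<in>zer (sum_op n A B). tuple_weakly_converges n x (\<lambda>i\<in>{1..n}. x'))"
proof -
  have "0 < lam" "2 * lam * L < 1" using lam L by (simp_all add: field_simps)
  then interpret ring_splitting n L lam A B
    using n L A B_mono B_lip by unfold_locales
  \<comment> \<open>The boundary values are written at 0 and \<open>n\<close> for z and at 0 for x,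
    all outside the index sets of the given tuples, so no component is changed.\<close>
  define Z X where "Z k = (z k)(0 := x k 1, n := x k 1)" and "X k = (x k)(0 := x k 1)" for k
  have Z: "Z k i = z k i" if "i \<in> {1..<n}" for k i using that by (simp add: Z_def)
  have X: "X k i = x k i" if "i \<in> {1..n}" for k i using that by (simp add: X_def)
  have splitting: "splitting (Z k) (X k)" for k
    unfolding Z_def X_def by (rule splittingI[OF x_1 x_2 x_i x_n])
  have step: "Z (Suc k) i = Z k i + \<gamma> *\<^sub>R (X k (Suc i) - X k i)" if "i \<in> {1..<n}" for k i
    using that z_Suc[of i k] by (fastforce simp: Z X)
  have "0 < \<gamma>" "\<gamma> < 1 - 2 * lam * L" using \<gamma> by simp_all
  then obtain q p where q: "splitting q (\<lambda>_. p)"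
    and weak_Z: "\<And>i. i \<in> {1..<n} \<Longrightarrow> weakly_tendsto (\<lambda>k. Z k i) (q i) sequentially"
    and weak_X: "\<And>i. i \<in> {1..n} \<Longrightarrow> weakly_tendsto (\<lambda>k. X k i) p sequentially"
    using splitting_iteration_converges[where \<gamma> = \<gamma> and z = Z and x = X, OF zer _ _ splitting step] by blast
  have "tuple_weakly_converges (n - 1) z (restrict q {1..n-1})"
  proof (rule tuple_weakly_convergesI)
    fix i assume i: "i \<in> {1..n-1}"
    then have "i \<in> {1..<n}" by auto
    then show "weakly_tendsto (\<lambda>k. z k i) (restrict q {1..n-1} i) sequentially"
      using weak_Z[of i] i by (simp add: Z)
  qed
  moreover have "tuple_weakly_converges n x (\<lambda>i\<in>{1..n}. p)"
    using weak_X by (intro tuple_weakly_convergesI) (simp add: X)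
  moreover have "p \<in> zer (sum_op n A B)" using q zer_iff_splitting by blast
  ultimately show ?thesis using Fix_T_tilde_of_splitting[OF q] by blast
qed

end
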